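(* There is a fully polynomial time approximation scheme (FPTAS) for the Unbounded Knapsack Problem whose algorithm $A_\varepsilon$, on an instance with $n$ items, has running time in $O\!\left(n + \frac{1}{\varepsilon^2}\log^3\frac{1}{\varepsilon}\right)$ and space complexity in $O\!\left(n + \frac{1}{\varepsilon}\log^2\frac{1}{\varepsilon}\right)$.
   Context: Unbounded Knapsack Problem (UKP): an instance $I$ consists of $n$ items $a_1,\dots,a_n$, each with a profit $p_j\in(0,1]$ and a size $s_j\in(0,1]$, and the knapsack capacity $c=1$. The goal is to determine $\max\{\sum_{j=1}^n p_jx_j : \sum_{j=1}^n s_jx_j\le c,\ x_j\in\mathbb{N}\ \forall j\}$ (an arbitrary number of copies of each item may be taken); $\mathrm{OPT}(I)$ denotes this optimum. An FPTAS is a family of algorithms $(A_\varepsilon)_{\varepsilon>0}$ such that for every $\varepsilon>0$ and every instance $I$, $A_\varepsilon$ returns a feasible solution of profit at least $(1-\varepsilon)\mathrm{OPT}(I)$, with running time polynomial in the input length and $1/\varepsilon$. Computational model: basic arithmetic operations and computing logarithms take $O(1)$ time. *)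

theory Defs
  imports Complex_Main
begin

section \<open>The unbounded knapsack problem\<close>

text \<open>An instance is the list of its items, given as pairs (profit, size); the capacity is 1.\<close>

type_synonym ukp = "(real \<times> real) list"

definition ukp_instance :: "ukp \<Rightarrow> bool" where
  "ukp_instance I \<longleftrightarrow> I \<noteq> [] \<and> (\<forall>(p, s) \<in> set I. 0 < p \<and> p \<le> 1 \<and> 0 < s \<and> s \<le> 1)"

definition total_profit :: "ukp \<Rightarrow> (nat \<Rightarrow> nat) \<Rightarrow> real" where
  "total_profit I x = (\<Sum>j<length I. fst (I ! j) * real (x j))"

definition total_size :: "ukp \<Rightarrow> (nat \<Rightarrow> nat) \<Rightarrow> real" where
  "total_size I x = (\<Sum>j<length I. snd (I ! j) * real (x j))"

definition feasible :: "ukp \<Rightarrow> (nat \<Rightarrow> nat) \<Rightarrow> bool" where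
  "feasible I x \<longleftrightarrow> total_size I x \<le> 1"

definition OPT :: "ukp \<Rightarrow> real" where
  "OPT I = Max {total_profit I x | x. feasible I x}"

lemma finite_feasible_profits:
  assumes "ukp_instance I"
  shows "finite {total_profit I x | x. feasible I x}"
proof -
  define b where "b = (\<lambda>j. nat \<lfloor>1 / snd (I ! j)\<rfloor>)"
  define F where "F = {xs. set xs \<subseteq> {..Max (b ` {..<length I})} \<and> length xs = length I}"
  have pos: "snd (I ! j) > 0" if "j < length I" for j
    using assms nth_mem[OF that] by (cases "I ! j") (auto simp: ukp_instance_def)
  have "total_profit I x \<in> (\<lambda>xs. total_profit I (\<lambda>j. xs ! j)) ` F" if f: "feasible I x" for x
  proof (rule image_eqI)
    have "x j \<le> b j" if j: "j < length I" for j
    proof -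
      have "snd (I ! j) * real (x j) \<le> total_size I x"
        unfolding total_size_def using j pos
        by (intro member_le_sum[where f = "\<lambda>j. snd (I ! j) * real (x j)"])
          (simp_all add: order_less_imp_le)
      then have "real (x j) \<le> 1 / snd (I ! j)"
        using f pos[OF j] by (simp add: feasible_def field_simps)
      then show ?thesis by (simp add: b_def le_nat_floor)
    qed
    then have "x j \<le> Max (b ` {..<length I})" if "j < length I" for j
      using that by (meson Max_ge finite_imageI finite_lessThan image_eqI lessThan_iff order_trans)
    then show "map x [0..<length I] \<in> F" by (auto simp: F_def)
    show "total_profit I x = total_profit I (\<lambda>j. map x [0..<length I] ! j)"
      by (simp add: total_profit_def)
  qed
  then have "{total_profit I x | x. feasible I x} \<subseteq> (\<lambda>xs. total_profit I (\<lambda>j. xs ! j)) ` F"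
    by blast
  moreover have "finite F" unfolding F_def by (rule finite_lists_length_eq) simp
  ultimately show ?thesis by (rule finite_subset[OF _ finite_imageI])
qed

lemma OPT_attained:
  assumes "ukp_instance I"
  shows "\<exists>x. feasible I x \<and> total_profit I x = OPT I"
proof -
  have "feasible I (\<lambda>_. 0)" by (simp add: feasible_def total_size_def)
  then have "{total_profit I x | x. feasible I x} \<noteq> {}" by blast
  from Max_in[OF finite_feasible_profits[OF assms] this] show ?thesis
    by (auto simp: OPT_def)
qed

section \<open>Computational model\<close>

text \<open>
  A unit-cost random access machine over exact real numbers: finitely many directly addressed
  registers per program, and a memory accessed only indirectly, through an address held in a
  register. Basic arithmetic, rounding down, binary logarithms, comparisons and memory accesses take
  one step each. Programs are structured (while programs) rather than lists of jumps. Constants are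
  integers, so that no information can be hidden in a program's real constants.
\<close>

datatype expr =
    Const int
  | Reg nat
  | Add nat nat
  | Sub nat nat
  | Mul nat nat
  | Div nat nat
  | Floor nat
  | Log nat

datatype test = Less nat nat | LessEq nat nat | Equal nat nat

datatype prog =
    Skip
  | Assign nat expr
  | Load nat nat
  | Store nat nat
  | Seq prog prog
  | If test prog prog
  | While test prog

type_synonym state = "(nat \<Rightarrow> real) \<times> (nat \<Rightarrow> real)"

fun eval_expr :: "(nat \<Rightarrow> real) \<Rightarrow> expr \<Rightarrow> real option" where
  "eval_expr R (Const k) = Some (real_of_int k)"
| "eval_expr R (Reg a) = Some (R a)"
| "eval_expr R (Add a b) = Some (R a + R b)"
| "eval_expr R (Sub a b) = Some (R a - R b)"
| "eval_expr R (Mul a b) = Some (R a * R b)"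
| "eval_expr R (Div a b) = (if R b = 0 then None else Some (R a / R b))"
| "eval_expr R (Floor a) = Some (real_of_int \<lfloor>R a\<rfloor>)"
| "eval_expr R (Log a) = (if R a > 0 then Some (log 2 (R a)) else None)"

fun eval_test :: "(nat \<Rightarrow> real) \<Rightarrow> test \<Rightarrow> bool" where
  "eval_test R (Less a b) \<longleftrightarrow> R a < R b"
| "eval_test R (LessEq a b) \<longleftrightarrow> R a \<le> R b"
| "eval_test R (Equal a b) \<longleftrightarrow> R a = R b"

text \<open>
  In \<open>exec P \<sigma> t m \<sigma>'\<close>, the program terminates after \<open>t\<close> steps, and \<open>m\<close> is the least number such
  that all memory accesses are to addresses below \<open>m\<close>; unused gaps between the accessed cells are
  thus charged as space. Division by zero, logarithms of nonpositive numbers and addresses that are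
  not natural numbers make the execution fail.
\<close>

inductive exec :: "prog \<Rightarrow> state \<Rightarrow> nat \<Rightarrow> nat \<Rightarrow> state \<Rightarrow> bool" where
  Skip: "exec Skip \<sigma> 1 0 \<sigma>"
| Assign: "eval_expr R e = Some v \<Longrightarrow> exec (Assign r e) (R, M) 1 0 (R(r := v), M)"
| Load: "R a = real i \<Longrightarrow> exec (Load r a) (R, M) 1 (Suc i) (R(r := M i), M)"
| Store: "R a = real i \<Longrightarrow> exec (Store a r) (R, M) 1 (Suc i) (R, M(i := R r))"
| Seq: "exec P \<sigma> t m \<sigma>' \<Longrightarrow> exec Q \<sigma>' t' m' \<sigma>'' \<Longrightarrow> exec (Seq P Q) \<sigma> (t + t') (max m m') \<sigma>''"
| IfTrue: "eval_test (fst \<sigma>) b \<Longrightarrow> exec P \<sigma> t m \<sigma>' \<Longrightarrow> exec (If b P Q) \<sigma> (Suc t) m \<sigma>'"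
| IfFalse: "\<not> eval_test (fst \<sigma>) b \<Longrightarrow> exec Q \<sigma> t m \<sigma>' \<Longrightarrow> exec (If b P Q) \<sigma> (Suc t) m \<sigma>'"
| WhileFalse: "\<not> eval_test (fst \<sigma>) b \<Longrightarrow> exec (While b P) \<sigma> 1 0 \<sigma>"
| WhileTrue: "eval_test (fst \<sigma>) b \<Longrightarrow> exec P \<sigma> t m \<sigma>' \<Longrightarrow> exec (While b P) \<sigma>' t' m' \<sigma>'' \<Longrightarrow>
    exec (While b P) \<sigma> (Suc (t + t')) (max m m') \<sigma>''"

inductive_cases SkipE: "exec Skip \<sigma> t m \<sigma>'"
inductive_cases AssignE: "exec (Assign r e) \<sigma> t m \<sigma>'"
inductive_cases LoadE: "exec (Load r a) \<sigma> t m \<sigma>'"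
inductive_cases StoreE: "exec (Store a r) \<sigma> t m \<sigma>'"
inductive_cases SeqE: "exec (Seq P Q) \<sigma> t m \<sigma>'"
inductive_cases IfE: "exec (If b P Q) \<sigma> t m \<sigma>'"
inductive_cases WhileE: "exec (While b P) \<sigma> t m \<sigma>'"

lemma exec_deterministic:
  "exec P \<sigma> t m \<sigma>' \<Longrightarrow> exec P \<sigma> t2 m2 \<sigma>2 \<Longrightarrow> t2 = t \<and> m2 = m \<and> \<sigma>2 = \<sigma>'"
proof (induction arbitrary: t2 m2 \<sigma>2 rule: exec.induct)
  case (Skip \<sigma>) then show ?case by (auto elim: SkipE)
next
  case (Assign R e v r M) then show ?case by (auto elim!: AssignE)
next
  case (Load R a i r M) then show ?case by (auto elim!: LoadE)
next
  case (Store R a i r M) then show ?case by (auto elim!: StoreE)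
next
  case (Seq P \<sigma> t m \<sigma>' Q t' m' \<sigma>'') then show ?case by (blast elim!: SeqE)
next
  case (IfTrue \<sigma> b P t m \<sigma>' Q) then show ?case by (blast elim!: IfE)
next
  case (IfFalse \<sigma> b Q t m \<sigma>' P) then show ?case by (blast elim!: IfE)
next
  case (WhileFalse \<sigma> b P) then show ?case by (auto elim: WhileE)
next
  case (WhileTrue \<sigma> b P t m \<sigma>' t' m' \<sigma>'')
  from WhileTrue.prems show ?case
    by (rule WhileE) (use WhileTrue.hyps(1) WhileTrue.IH in blast)+
qed

section \<open>Approximation schemes\<close>

text \<open>
  Register 0 holds the number \<open>n\<close> of items and register 1 holds the accuracy \<open>\<epsilon>\<close>; the memory holds
  the profits at the addresses from 0 to \<open>n - 1\<close> and the sizes at those from \<open>n\<close> to \<open>2n - 1\<close>.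
  The solution is left in the memory at the addresses from 0 to \<open>n - 1\<close>.
\<close>

definition initial_state :: "real \<Rightarrow> ukp \<Rightarrow> state" where
  "initial_state \<epsilon> I = (let n = length I in
     (\<lambda>r. if r = 0 then real n else if r = 1 then \<epsilon> else 0,
      \<lambda>i. if i < n then fst (I ! i) else if i < 2 * n then snd (I ! (i - n)) else 0))"

definition output_solution :: "ukp \<Rightarrow> state \<Rightarrow> (nat \<Rightarrow> nat) \<Rightarrow> bool" where
  "output_solution I \<sigma> x \<longleftrightarrow> (\<forall>j < length I. snd \<sigma> j = real (x j))"

text \<open>
  The members of the family are a single program \<open>A\<close> supplied with the value of \<open>\<epsilon>\<close>; the bounds
  below are therefore uniform in \<open>\<epsilon>\<close>, and no member can contain tables prepared for its \<open>\<epsilon>\<close>.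
  Since \<open>exec\<close> is deterministic, the existential quantifiers speak about the unique run.
  The bounds are required for all \<open>n \<ge> 1\<close> and all \<open>\<epsilon> > 0\<close>. This does not degenerate for a bound
  such as \<open>n + 1/\<epsilon>^2 * (log 2 (1/\<epsilon>))^3\<close>: where the logarithm is negative (\<open>\<epsilon> > 1\<close>), the second
  summand is at least \<open>-0.51\<close>.
\<close>

definition runs_in_time :: "prog \<Rightarrow> (nat \<Rightarrow> real \<Rightarrow> real) \<Rightarrow> bool" where
  "runs_in_time A f \<longleftrightarrow> (\<forall>\<epsilon> I. 0 < \<epsilon> \<longrightarrow> ukp_instance I \<longrightarrow>
     (\<exists>t m \<sigma>. exec A (initial_state \<epsilon> I) t m \<sigma> \<and> real t \<le> f (length I) \<epsilon>))"

text \<open>The space includes the input; the registers contribute only a constant for each program.\<close>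

definition runs_in_space :: "prog \<Rightarrow> (nat \<Rightarrow> real \<Rightarrow> real) \<Rightarrow> bool" where
  "runs_in_space A f \<longleftrightarrow> (\<forall>\<epsilon> I. 0 < \<epsilon> \<longrightarrow> ukp_instance I \<longrightarrow>
     (\<exists>t m \<sigma>. exec A (initial_state \<epsilon> I) t m \<sigma> \<and> real (max (2 * length I) m) \<le> f (length I) \<epsilon>))"

definition ukp_approximation_scheme :: "prog \<Rightarrow> bool" where
  "ukp_approximation_scheme A \<longleftrightarrow> (\<forall>\<epsilon> I. 0 < \<epsilon> \<longrightarrow> ukp_instance I \<longrightarrow>
     (\<exists>t m \<sigma> x. exec A (initial_state \<epsilon> I) t m \<sigma> \<and> output_solution I \<sigma> x \<and>
        feasible I x \<and> total_profit I x \<ge> (1 - \<epsilon>) * OPT I))"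

text \<open>At unit cost per number, the input length is proportional to the number \<open>n\<close> of items.\<close>

definition ukp_fptas :: "prog \<Rightarrow> bool" where
  "ukp_fptas A \<longleftrightarrow> ukp_approximation_scheme A \<and>
     (\<exists>C k. runs_in_time A (\<lambda>n \<epsilon>. C * (real n + 1 / \<epsilon>) ^ k))"

end

(*
Let P be the largest density p/s; then P/2 <= OPT <= P. With B = P/2^K and 2^K about 8/eps, an item of
profit at most B is replaced by a bundle of copies of profit between B and 2B, which costs at most one
bundle of the densest such item. Every bundled item then has a profit in some class [B 2^l, B 2^(l+1)),
l <= K. Profits of class l are rounded down to multiples of grid l = 2 B 2^l / N, where N is about K 2^K,
so that each level has N + 1 values. The table holds, for each level l and each i <= N, the least size
of a multiset with profit at least i * grid l, obtained as a single item of class l or as a pair of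
entries of level l - 1; a level costs N^2 steps. Since the weights 2^l of the items of a solution sum
to at most 2^K, a solution can be hung into a binary tree of height K (Kraft's inequality). At level l
the tree has O(2^(K - l)) nodes, each losing at most grid l in the rounding, so the total loss per level
is O(P/N) and the loss over all levels O(K P/N) = O(eps OPT). The solution is recovered by pushing
multiplicities down the table.
*)

theory Submission
  imports Defs
begin

section \<open>Verification conditions\<close>

text \<open>The constants balance two losses. Giving up one bundle costs at most
  \<open>2 * B = 2 * P / 2 ^ K\<close>. Rounding costs \<open>2 * P / N\<close> at the leaves and at
  most \<open>3 * P / N\<close> in each of the \<open>K\<close> merging steps;
  \<open>N = (K + 1) * 2 ^ (K + 1)\<close> brings the sum of these below
  \<open>2 * P / 2 ^ K\<close> as well. Since \<open>8 / \<epsilon> \<le> 2 ^ K\<close>, the total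
  \<open>4 * P / 2 ^ K\<close> is at most \<open>\<epsilon> * P / 2\<close>, hence at most
  \<open>\<epsilon> * OPT\<close>. The grid doubles from one level to the next, so merging two
  entries averages their indices and never leaves the range up to \<open>N\<close>. This keeps all
  levels equally wide. No statement says that the table holds exact minima. Two one-sided conditions
  suffice: \<open>complete\<close> (every item and every pair has been taken into account, so no
  good solution is missed) and \<open>sound\<close> (every entry present can be turned into items).
  Improving an entry cannot break the certificates of the others. The bounds are claimed for every
  \<epsilon>, also where the logarithm is negative. There the time bound rests on the negative
  summand staying above a constant larger than -1.\<close>

abbreviation seq_syntax (infixr ";;" 60) where "P ;; Q \<equiv> Seq P Q"

type_synonym assn = "(nat \<Rightarrow> real) \<Rightarrow> (nat \<Rightarrow> real) \<Rightarrow> bool"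

text \<open>Time and memory are upper bounds, so that branches of different cost need not be told
  apart. Time adds up along a sequence, while memory combines by maximum; one \<open>m\<close>
  therefore serves all parts of a program.\<close>

definition runs :: "prog \<Rightarrow> state \<Rightarrow> nat \<Rightarrow> nat \<Rightarrow> assn \<Rightarrow> bool" where
  "runs P \<sigma> T m Q \<longleftrightarrow>
     (\<exists>t m' R M. exec P \<sigma> t m' (R, M) \<and> t \<le> T \<and> m' \<le> m \<and> Q R M)"

fun defined :: "expr \<Rightarrow> (nat \<Rightarrow> real) \<Rightarrow> bool" where
  "defined (Div a b) R \<longleftrightarrow> R b \<noteq> 0"
| "defined (Log a) R \<longleftrightarrow> 0 < R a"
| "defined _ R \<longleftrightarrow> True"

fun expr_value :: "expr \<Rightarrow> (nat \<Rightarrow> real) \<Rightarrow> real" where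
  "expr_value (Const k) R = real_of_int k"
| "expr_value (Reg a) R = R a"
| "expr_value (Add a b) R = R a + R b"
| "expr_value (Sub a b) R = R a - R b"
| "expr_value (Mul a b) R = R a * R b"
| "expr_value (Div a b) R = R a / R b"
| "expr_value (Floor a) R = real_of_int \<lfloor>R a\<rfloor>"
| "expr_value (Log a) R = log 2 (R a)"

definition address :: "real \<Rightarrow> nat" where "address x = nat \<lfloor>x\<rfloor>"

lemma address_of_nat [simp]: "address (real i) = i"
  by (simp add: address_def)

text \<open>Loops are left to \<open>runs_While\<close>; hence the value \<open>False\<close>.\<close>

fun wp :: "prog \<Rightarrow> nat \<Rightarrow> assn \<Rightarrow> assn" where
  "wp Skip m Q R M = Q R M"
| "wp (Assign r e) m Q R M = (defined e R \<and> Q (R(r := expr_value e R)) M)"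
| "wp (Load r a) m Q R M =
    (R a = real (address (R a)) \<and> address (R a) < m \<and> Q (R(r := M (address (R a)))) M)"
| "wp (Store a r) m Q R M =
    (R a = real (address (R a)) \<and> address (R a) < m \<and> Q R (M(address (R a) := R r)))"
| "wp (Seq P P') m Q R M = wp P m (wp P' m Q) R M"
| "wp (If b P P') m Q R M = (if eval_test R b then wp P m Q R M else wp P' m Q R M)"
| "wp (While b P) m Q R M = False"

fun cost :: "prog \<Rightarrow> nat" where
  "cost (Seq P Q) = cost P + cost Q"
| "cost (If b P Q) = Suc (max (cost P) (cost Q))"
| "cost _ = 1"

lemma eval_expr_defined: "defined e R \<Longrightarrow> eval_expr R e = Some (expr_value e R)"
  by (cases e) auto

lemma runs_wp: "wp P m Q R M \<Longrightarrow> runs P (R, M) (cost P) m Q"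
proof (induction P arbitrary: Q R M)
  case Skip
  then show ?case
    unfolding runs_def by (force intro: exec.Skip)
next
  case (Assign r e)
  then have "eval_expr R e = Some (expr_value e R)" "Q (R(r := expr_value e R)) M"
    by (auto intro: eval_expr_defined)
  then show ?case
    unfolding runs_def by (force intro: exec.Assign)
next
  case (Load r a)
  then obtain i where i: "R a = real i" "i < m" "Q (R(r := M i)) M" by auto
  then show ?case
    unfolding runs_def using exec.Load[of R a i r M, OF i(1)] by fastforce
next
  case (Store a r)
  then obtain i where i: "R a = real i" "i < m" "Q R (M(i := R r))" by auto
  then show ?case
    unfolding runs_def using exec.Store[of R a i r M, OF i(1)] by fastforce
next
  case (Seq P1 P2)
  then have "runs P1 (R, M) (cost P1) m (wp P2 m Q)" by auto
  then obtain t1 m1 R1 M1 where 1: "exec P1 (R, M) t1 m1 (R1, M1)" "t1 \<le> cost P1" "m1 \<le> m"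
      "wp P2 m Q R1 M1"
    unfolding runs_def by blast
  from Seq.IH(2)[OF 1(4)] obtain t2 m2 R2 M2
    where 2: "exec P2 (R1, M1) t2 m2 (R2, M2)" "t2 \<le> cost P2" "m2 \<le> m" "Q R2 M2"
    unfolding runs_def by blast
  show ?case
    unfolding runs_def using exec.Seq[OF 1(1) 2(1)] 1 2
    by (intro exI[of _ "t1 + t2"] exI[of _ "max m1 m2"] exI[of _ R2] exI[of _ M2]) auto
next
  case (If b P1 P2)
  show ?case
  proof (cases "eval_test R b")
    case True
    then have "runs P1 (R, M) (cost P1) m Q" using If by auto
    then obtain t m' R' M' where "exec P1 (R, M) t m' (R', M')" "t \<le> cost P1" "m' \<le> m" "Q R' M'"
      unfolding runs_def by blast
    then show ?thesis
      unfolding runs_def using exec.IfTrue[of "(R, M)" b P1 t m' "(R', M')" P2] True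
      by (intro exI[of _ "Suc t"] exI[of _ m'] exI[of _ R'] exI[of _ M']) auto
  next
    case False
    then have "runs P2 (R, M) (cost P2) m Q" using If by auto
    then obtain t m' R' M' where "exec P2 (R, M) t m' (R', M')" "t \<le> cost P2" "m' \<le> m" "Q R' M'"
      unfolding runs_def by blast
    then show ?thesis
      unfolding runs_def using exec.IfFalse[of "(R, M)" b P2 t m' "(R', M')" P1] False
      by (intro exI[of _ "Suc t"] exI[of _ m'] exI[of _ R'] exI[of _ M']) auto
  qed
qed auto

lemma runs_Seq:
  assumes "runs P \<sigma> T m Q" and "\<And>R M. Q R M \<Longrightarrow> runs P' (R, M) T' m Q'"
  shows "runs (P ;; P') \<sigma> (T + T') m Q'"
proof -
  obtain t1 m1 R1 M1 where 1: "exec P \<sigma> t1 m1 (R1, M1)" "t1 \<le> T" "m1 \<le> m" "Q R1 M1"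
    using assms(1) unfolding runs_def by blast
  obtain t2 m2 R2 M2 where 2: "exec P' (R1, M1) t2 m2 (R2, M2)" "t2 \<le> T'" "m2 \<le> m" "Q' R2 M2"
    using assms(2)[OF 1(4)] unfolding runs_def by blast
  show ?thesis
    unfolding runs_def using exec.Seq[OF 1(1) 2(1)] 1 2
    by (intro exI[of _ "t1 + t2"] exI[of _ "max m1 m2"] exI[of _ R2] exI[of _ M2]) auto
qed

lemma runs_mono: "runs P \<sigma> T m Q \<Longrightarrow> T \<le> T' \<Longrightarrow> runs P \<sigma> T' m Q"
  unfolding runs_def by (meson order_trans)

text \<open>Every loop of the program counts a register up to a bound, so the invariant can carry
  the iteration number and termination needs no argument of its own. The body goes through
  \<open>wp\<close> and is thus free of loops. The summands 1 pay for the tests, including the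
  failing one.\<close>

lemma runs_While:
  assumes Inv: "\<And>k R M. Inv k R M \<Longrightarrow> R i = real k \<and> R b = real n"
    and body: "\<And>k R M. k < n \<Longrightarrow> Inv k R M \<Longrightarrow> wp P m (Inv (Suc k)) R M"
    and init: "Inv 0 R M"
  shows "runs (While (Less i b) P) (R, M) (n * Suc (cost P) + 1) m (Inv n)"
proof -
  have "runs (While (Less i b) P) (R, M) ((n - k) * Suc (cost P) + 1) m (Inv n)"
    if "k \<le> n" "Inv k R M" for k R M
    using that
  proof (induction "n - k" arbitrary: k R M)
    case 0
    then have "\<not> eval_test (fst (R, M)) (Less i b)" using Inv[of k R M] by auto
    from exec.WhileFalse[OF this, of P] 0 show ?case
      unfolding runs_def by fastforce
  next
    case (Suc d)
    then have k: "k < n" by simp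
    then have test: "eval_test (fst (R, M)) (Less i b)" using Inv[of k R M] Suc by auto
    obtain t1 m1 R1 M1 where 1: "exec P (R, M) t1 m1 (R1, M1)" "t1 \<le> cost P" "m1 \<le> m"
        "Inv (Suc k) R1 M1"
      using runs_wp[OF body[OF k Suc.prems(2)]] unfolding runs_def by blast
    have IH: "runs (While (Less i b) P) (R1, M1) ((n - Suc k) * Suc (cost P) + 1) m (Inv n)"
      using Suc.hyps(2) k by (intro Suc.hyps(1) 1(4)) auto
    obtain t2 m2 R2 M2 where 2: "exec (While (Less i b) P) (R1, M1) t2 m2 (R2, M2)"
        "t2 \<le> (n - Suc k) * Suc (cost P) + 1" "m2 \<le> m" "Inv n R2 M2"
      using IH unfolding runs_def by blast
    have "n - k = Suc (n - Suc k)" using k by simp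
    then have "Suc (t1 + t2) \<le> (n - k) * Suc (cost P) + 1" using 1(2) 2(2) by simp
    then show ?case
      unfolding runs_def using exec.WhileTrue[OF test 1(1) 2(1)] 1 2
      by (intro exI[of _ "Suc (t1 + t2)"] exI[of _ "max m1 m2"] exI[of _ R2] exI[of _ M2]) auto
  qed
  from this[of 0] init show ?thesis by simp
qed

section \<open>Bundling, rounding and packing\<close>

locale ukp_rounding =
  fixes n :: nat and p s :: "nat \<Rightarrow> real" and K :: nat and P :: real
  assumes p_pos: "j < n \<Longrightarrow> 0 < p j"
    and s_pos: "j < n \<Longrightarrow> 0 < s j"
    and s_le_1: "j < n \<Longrightarrow> s j \<le> 1"
    and density_le: "j < n \<Longrightarrow> p j \<le> P * s j"
    and density_attained: "\<exists>j<n. p j = P * s j"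
    and K_pos: "K \<ge> 1"
begin

definition N :: nat where "N = (K + 1) * 2 ^ (K + 1)"
definition W :: nat where "W = N + 1"
definition B :: real where "B = P / 2 ^ K"

text \<open>The least number of copies with profit strictly above \<open>B\<close>. It is 1 when
  \<open>B < p j\<close>, so items that need no bundling are not a separate case.\<close>

definition copies :: "nat \<Rightarrow> nat" where "copies j = nat \<lfloor>B / p j\<rfloor> + 1"
definition pp :: "nat \<Rightarrow> real" where "pp j = real (copies j) * p j"
definition ss :: "nat \<Rightarrow> real" where "ss j = real (copies j) * s j"
definition level :: "nat \<Rightarrow> nat" where "level j = nat \<lfloor>log 2 (pp j / B)\<rfloor>"
definition index :: "nat \<Rightarrow> nat" where "index j = nat \<lfloor>pp j * N / (2 * B * 2 ^ level j)\<rfloor>"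
definition leaf :: "nat \<Rightarrow> nat" where "leaf j = level j * W + index j"

definition grid :: "nat \<Rightarrow> real" where "grid l = 2 * B * 2 ^ l / N"
definition val :: "nat \<Rightarrow> real" where "val q = real (q mod W) * grid (q div W)"

text \<open>Two entries \<open>l * W + a\<close> and \<open>l * W + b\<close> of one level are coded
  by the single number \<open>z = (l * W + a) * W + b\<close>. One counting loop over
  \<open>z\<close> then replaces three nested ones and visits the levels in increasing
  order.\<close>

definition left :: "nat \<Rightarrow> nat" where "left z = z div W"
definition right :: "nat \<Rightarrow> nat" where "right z = left z div W * W + z mod W"
definition parent :: "nat \<Rightarrow> nat" where
  "parent z = (left z div W + 1) * W + (left z mod W + z mod W) div 2"

definition profit :: "(nat \<Rightarrow> nat) \<Rightarrow> real" where "profit x = (\<Sum>j<n. p j * real (x j))"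
definition usage :: "(nat \<Rightarrow> nat) \<Rightarrow> real" where "usage x = (\<Sum>j<n. s j * real (x j))"

text \<open>Here \<open>2 - w q\<close> is the size recorded for entry \<open>q\<close>, so adding
  two sizes becomes \<open>w u + w v - 2\<close>. Entry 0 stands for the empty multiset.\<close>

definition complete :: "(nat \<Rightarrow> real) \<Rightarrow> bool" where
  "complete w \<longleftrightarrow> 2 \<le> w 0 \<and> (\<forall>j<n. 2 - ss j \<le> w (leaf j)) \<and>
     (\<forall>z<K * W * W. w (left z) + w (right z) - 2 \<le> w (parent z))"

lemma n_pos: "n > 0"
  using density_attained by auto

lemma P_pos: "P > 0"
  using density_attained p_pos s_pos by (metis zero_less_mult_pos2)

lemma B_pos: "B > 0"
  using P_pos by (simp add: B_def)

lemma N_pos: "N > 0"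
  by (simp add: N_def)

lemma W_pos: "W > 0"
  by (simp add: W_def)

lemma grid_nonneg: "grid l \<ge> 0"
  using B_pos by (simp add: grid_def)

section \<open>Bounds on the optimum from the largest density\<close>

lemma profit_le: "profit x \<le> P * usage x"
  unfolding profit_def usage_def sum_distrib_left
  by (rule sum_mono) (use density_le in \<open>auto simp: mult.assoc[symmetric] intro!: mult_right_mono\<close>)

lemma profit_le_P: "usage x \<le> 1 \<Longrightarrow> profit x \<le> P"
  using profit_le[of x] P_pos mult_left_mono[of "usage x" 1 P] by linarith

text \<open>Copies of a densest item fill at least half of the knapsack, because rounding down a
  number that is at least 1 loses at most half of it.\<close>

lemma half_P_attained: "\<exists>x. usage x \<le> 1 \<and> P / 2 \<le> profit x"
proof -
  obtain j where j: "j < n" "p j = P * s j" using density_attained by auto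
  define m where "m = nat \<lfloor>1 / s j\<rfloor>"
  have s1: "1 / s j \<ge> 1" using j s_pos s_le_1 by simp
  then have f1: "\<lfloor>1 / s j\<rfloor> \<ge> 1" by (simp add: le_floor_iff)
  then have m: "real m = of_int \<lfloor>1 / s j\<rfloor>" unfolding m_def by (intro of_nat_nat) linarith
  have le: "real m \<le> 1 / s j" unfolding m by simp
  have "1 / s j < real m + 1" unfolding m by linarith
  moreover have "real m \<ge> 1" using f1 m by simp
  ultimately have ge: "1 / s j \<le> 2 * real m" by linarith
  define x where "x = (\<lambda>i. if i = j then m else 0)"
  have "usage x = s j * m" "profit x = p j * m"
    unfolding usage_def profit_def x_def using j(1) by (simp_all add: if_distrib cong: if_cong)
  moreover have "s j * m \<le> 1" using le s_pos[OF j(1)] by (simp add: field_simps)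
  moreover have "1 \<le> 2 * (s j * m)" using ge s_pos[OF j(1)] by (simp add: field_simps)
  then have "P / 2 * 1 \<le> P / 2 * (2 * (s j * m))" using P_pos by (intro mult_left_mono) auto
  then have "P / 2 \<le> p j * m" by (simp add: j(2) mult_ac)
  ultimately show ?thesis by (intro exI[of _ x]) simp
qed

section \<open>Bundles, their profit classes and the rounding of their profits\<close>

lemma of_nat_copies: "j < n \<Longrightarrow> real (copies j) = of_int \<lfloor>B / p j\<rfloor> + 1"
  using p_pos[of j] B_pos by (simp add: copies_def)

lemma pp_gt: "j < n \<Longrightarrow> B < pp j"
proof -
  assume j: "j < n"
  have "B / p j < real (copies j)" using of_nat_copies[OF j] by linarith
  then show ?thesis using p_pos[OF j] by (simp add: pp_def field_simps)
qed

lemma pp_le: "j < n \<Longrightarrow> pp j \<le> B + p j"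
proof -
  assume j: "j < n"
  have "real (copies j) \<le> B / p j + 1" using of_nat_copies[OF j] by linarith
  then show ?thesis using p_pos[OF j] by (simp add: pp_def field_simps)
qed

lemma copies_large: "j < n \<Longrightarrow> B < p j \<Longrightarrow> copies j = 1"
proof -
  assume j: "j < n" "B < p j"
  then have "\<lfloor>B / p j\<rfloor> = 0" using B_pos p_pos[OF j(1)] by (simp add: floor_eq_iff)
  then show ?thesis by (simp add: copies_def)
qed

text \<open>A bundle need not fit into the knapsack, so \<open>profit_le_P\<close> cannot be applied
  to it. Proper bundles are bounded by \<open>2 * B \<le> P\<close> instead, which is where
  \<open>K \<ge> 1\<close> enters.\<close>

lemma pp_le_P: "j < n \<Longrightarrow> pp j \<le> P"
proof -
  assume j: "j < n"
  show ?thesis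
  proof (cases "B < p j")
    case True
    have "p j \<le> P * s j" using density_le j by simp
    also have "\<dots> \<le> P" using s_le_1[OF j] P_pos by (simp add: mult_left_le)
    finally show ?thesis using copies_large[OF j True] by (simp add: pp_def)
  next
    case False
    have "(2::real) ^ 1 \<le> 2 ^ K" using K_pos by (intro power_increasing) auto
    then have "2 * B \<le> P" using P_pos by (simp add: B_def field_simps)
    then show ?thesis using pp_le[OF j] False by linarith
  qed
qed

lemma level_bounds:
  assumes "j < n"
  shows "real (level j) = of_int \<lfloor>log 2 (pp j / B)\<rfloor>"
    and "2 ^ level j * B \<le> pp j" and "pp j < 2 * 2 ^ level j * B"
proof -
  have g: "pp j / B > 1" using pp_gt[OF assms] B_pos by simp
  then have "log 2 (pp j / B) > 0" by simp
  then have fl: "\<lfloor>log 2 (pp j / B)\<rfloor> \<ge> 0" by simp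
  then show l: "real (level j) = of_int \<lfloor>log 2 (pp j / B)\<rfloor>" by (simp add: level_def)
  have "real (level j) \<le> log 2 (pp j / B)" using l by simp
  then have "2 powr (level j) \<le> pp j / B" using g by (simp add: le_log_iff)
  then show "2 ^ level j * B \<le> pp j" using B_pos by (simp add: powr_realpow field_simps)
  have "log 2 (pp j / B) < real (level j + 1)" using l by simp linarith
  then have "pp j / B < 2 powr (real (level j + 1))" using g by (subst (asm) log_less_iff) auto
  then have "pp j / B < 2 ^ (level j + 1)" by (subst (asm) powr_realpow) auto
  then show "pp j < 2 * 2 ^ level j * B" using B_pos by (simp add: field_simps)
qed

lemma level_le: "j < n \<Longrightarrow> level j \<le> K"
proof -
  assume j: "j < n"
  have "2 ^ level j * B \<le> 2 ^ K * B"
    using level_bounds(2)[OF j] pp_le_P[OF j] by (simp add: B_def)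
  then have "(2::real) ^ level j \<le> 2 ^ K" using B_pos by simp
  then show ?thesis by simp
qed

lemma index_bounds:
  assumes "j < n"
  shows "real (index j) = of_int \<lfloor>pp j * N / (2 * B * 2 ^ level j)\<rfloor>"
    and "index j \<le> N"
    and "real (index j) * grid (level j) \<le> pp j"
    and "pp j \<le> (real (index j) + 1) * grid (level j)"
proof -
  let ?y = "pp j * N / (2 * B * 2 ^ level j)"
  have pp0: "pp j > 0" using pp_gt[OF assms] B_pos by simp
  have y0: "?y \<ge> 0" using pp0 B_pos by simp
  then show eq: "real (index j) = of_int \<lfloor>?y\<rfloor>" by (simp add: index_def)
  have y: "?y * grid (level j) = pp j"
    using B_pos N_pos by (simp add: grid_def)
  have "?y \<le> N"
    using level_bounds(3)[OF assms] B_pos N_pos by (simp add: field_simps)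
  then have "real (index j) \<le> N" unfolding eq by linarith
  then show "index j \<le> N" by simp
  have "real (index j) \<le> ?y" unfolding eq by linarith
  from mult_right_mono[OF this grid_nonneg[of "level j"]]
  show "real (index j) * grid (level j) \<le> pp j" unfolding y .
  have "?y \<le> real (index j) + 1" unfolding eq by linarith
  from mult_right_mono[OF this grid_nonneg[of "level j"]] y
  show "pp j \<le> (real (index j) + 1) * grid (level j)" by simp
qed

section \<open>Arithmetic of table entries and of pairs\<close>

lemma node_less: "l \<le> K \<Longrightarrow> i \<le> N \<Longrightarrow> l * W + i < (K + 1) * W"
proof -
  assume "l \<le> K" "i \<le> N"
  then have "l * W \<le> K * W" "i < W" using mult_le_mono1[of l K W] by (auto simp: W_def simp del: mult_le_cancel2)
  then have "l * W + i < K * W + W" by (rule add_le_less_mono)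
  then show ?thesis by simp
qed

lemma leaf_less: "j < n \<Longrightarrow> leaf j < (K + 1) * W"
  unfolding leaf_def by (intro node_less level_le index_bounds)

lemma val_node: "i \<le> N \<Longrightarrow> val (l * W + i) = real i * grid l"
proof -
  assume "i \<le> N"
  then have "i < W" by (simp add: W_def)
  then show ?thesis by (simp add: val_def)
qed

lemma val_leaf: "j < n \<Longrightarrow> val (leaf j) \<le> pp j"
  unfolding leaf_def using index_bounds by (simp add: val_node)

text \<open>Operands lie below their result, which lets backtracking pass through the table once,
  downwards. The value of the result is never overstated, since the index sum is halved downwards
  while the grid exactly doubles.\<close>

lemma pair_bounds:
  assumes "z < K * W * W"
  shows "left z < K * W" "left z < parent z" "right z < parent z" "parent z < (K + 1) * W"
    "val (parent z) \<le> val (left z) + val (right z)"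
proof -
  define l where "l = left z div W"
  define a where "a = left z mod W"
  define b where "b = z mod W"
  have left: "left z = l * W + a" by (simp add: l_def a_def)
  have right: "right z = l * W + b" by (simp add: l_def b_def right_def)
  have parent: "parent z = (l + 1) * W + (a + b) div 2" by (simp add: l_def a_def b_def parent_def)
  have ab: "a \<le> N" "b \<le> N" using W_pos unfolding a_def b_def W_def
    by (metis Suc_eq_plus1 less_Suc_eq_le mod_less_divisor zero_less_Suc)+
  show "left z < K * W" using assms by (simp add: left_def less_mult_imp_div_less)
  then have l: "l < K" by (simp add: l_def less_mult_imp_div_less)
  show "left z < parent z" "right z < parent z" using ab by (simp_all add: left right parent W_def)
  show "parent z < (K + 1) * W" unfolding parent using l ab by (intro node_less) auto
  have "real ((a + b) div 2) * 2 \<le> real (a + b)" by linarith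
  from mult_right_mono[OF this grid_nonneg[of l]]
  have "real ((a + b) div 2) * (2 * grid l) \<le> real a * grid l + real b * grid l"
    by (simp add: algebra_simps)
  moreover have "grid (l + 1) = 2 * grid l" by (simp add: grid_def)
  ultimately show "val (parent z) \<le> val (left z) + val (right z)"
    unfolding left right parent using ab by (simp only: val_node)
qed

text \<open>The entry written at step \<open>z\<close> lies in a higher level than every operand
  read up to that step. Hence the write leaves the operands of all earlier pairs untouched, as
  \<open>pairs_done_update\<close> requires.\<close>

lemma pair_order: "z' \<le> z \<Longrightarrow> left z' < parent z" "z' \<le> z \<Longrightarrow> right z' < parent z"
proof -
  assume "z' \<le> z"
  then have "left z' div W \<le> left z div W" unfolding left_def by (intro div_le_mono)
  then have "left z' div W * W + W \<le> left z div W * W + W" by simp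
  also have "\<dots> \<le> parent z" by (simp add: parent_def)
  finally have *: "left z' div W * W + W \<le> parent z" .
  have "left z' = left z' div W * W + left z' mod W" by simp
  then show "left z' < parent z" using * W_pos by (metis add_less_cancel_left less_le_trans mod_less_divisor)
  show "right z' < parent z" unfolding right_def using * W_pos
    by (metis add_less_cancel_left less_le_trans mod_less_divisor)
qed

section \<open>Packing a solution into a binary tree of table entries\<close>

lemma complete_pair:
  assumes "complete w" "l < K" "a \<le> N" "b \<le> N"
  shows "w (l * W + a) + w (l * W + b) - 2 \<le> w ((l + 1) * W + (a + b) div 2)"
proof -
  define z where "z = (l * W + a) * W + b"
  have aW: "a < W" "b < W" using assms by (simp_all add: W_def)
  have zd: "z div W = l * W + a" "z mod W = b" using aW by (simp_all add: z_def)
  have "l * W + a < K * W"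
  proof -
    have "(l + 1) * W \<le> K * W" using assms(2) by (intro mult_right_mono) auto
    then show ?thesis using aW by simp
  qed
  then have "(l * W + a + 1) * W \<le> K * W * W" by (intro mult_right_mono) auto
  then have "z < K * W * W" using aW by (simp add: z_def)
  then have "w (left z) + w (right z) - 2 \<le> w (parent z)" using assms(1) by (simp add: complete_def)
  then show ?thesis using aW by (simp add: left_def right_def parent_def zd)
qed

text \<open>The empty multiset is available at every level. It serves as partner of a node left
  unpaired and as the root when there are no leaves at all.\<close>

lemma complete_zero:
  assumes "complete w" shows "l \<le> K \<Longrightarrow> 2 \<le> w (l * W)"
proof (induction l)
  case 0 then show ?case using assms by (simp add: complete_def)
next
  case (Suc l) then show ?case using complete_pair[OF assms, of l 0 0] by simp
qed

text \<open>Neighbours in the list are merged; a last node without neighbour is merged with the zero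
  entry, whence the \<open>+ 1\<close> in the length bound. Each merge halves an index sum downwards
  and so loses at most one unit of the finer grid, which accounts for
  \<open>length L'\<close>.\<close>

lemma pair_up:
  assumes w: "complete w" and l: "l < K"
  shows "set L \<subseteq> {..N} \<Longrightarrow> \<exists>L'. set L' \<subseteq> {..N} \<and> 2 * length L' \<le> length L + 1 \<and>
    (\<Sum>i\<leftarrow>L'. 2 - w ((l + 1) * W + i)) \<le> (\<Sum>i\<leftarrow>L. 2 - w (l * W + i)) \<and>
    sum_list L \<le> 2 * sum_list L' + length L'"
proof (induction L rule: induct_list012)
  case 1
  then show ?case by (intro exI[of _ "[]"]) simp
next
  case (2 a)
  have "w (l * W + a) \<le> w ((l + 1) * W + a div 2)"
    using complete_pair[OF w l, of a 0] complete_zero[OF w, of l] l 2 by simp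
  then show ?case using 2 by (intro exI[of _ "[a div 2]"]) auto
next
  case (3 a b L)
  then obtain L' where L': "set L' \<subseteq> {..N}" "2 * length L' \<le> length L + 1"
    "(\<Sum>i\<leftarrow>L'. 2 - w ((l + 1) * W + i)) \<le> (\<Sum>i\<leftarrow>L. 2 - w (l * W + i))"
    "sum_list L \<le> 2 * sum_list L' + length L'" by auto
  have "w (l * W + a) + w (l * W + b) - 2 \<le> w ((l + 1) * W + (a + b) div 2)"
    using complete_pair[OF w l] 3 by simp
  then show ?case using L' 3 by (intro exI[of _ "(a + b) div 2 # L'"]) auto
qed

text \<open>An item loses at most one grid step of its level, that is \<open>2 * B / N\<close> times
  its weight \<open>2 ^ level j\<close>. The rounding loss of all leaves is therefore proportional
  to the sum in Kraft's inequality.\<close>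

lemma leaves_at_level:
  assumes w: "complete w" and js: "set js \<subseteq> {..<n}" "\<forall>j\<in>set js. level j = l"
  shows "2 ^ l * length (map index js) = (\<Sum>j\<leftarrow>js. 2 ^ level j)"
    and "set (map index js) \<subseteq> {..N}"
    and "(\<Sum>i\<leftarrow>map index js. 2 - w (l * W + i)) \<le> (\<Sum>j\<leftarrow>js. ss j)"
    and "(\<Sum>j\<leftarrow>js. pp j) \<le> real (sum_list (map index js)) * grid l
           + 2 * B / N * real (\<Sum>j\<leftarrow>js. 2 ^ level j)"
proof -
  have "2 ^ l * length (map index js) = (\<Sum>j\<leftarrow>js. 2 ^ level j) \<and>
    set (map index js) \<subseteq> {..N} \<and>
    (\<Sum>i\<leftarrow>map index js. 2 - w (l * W + i)) \<le> (\<Sum>j\<leftarrow>js. ss j) \<and>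
    (\<Sum>j\<leftarrow>js. pp j) \<le> real (sum_list (map index js)) * grid l
           + 2 * B / N * real (\<Sum>j\<leftarrow>js. 2 ^ level j)"
    using js
  proof (induction js)
    case (Cons j js)
    then have j: "j < n" "level j = l" by auto
    have "2 - ss j \<le> w (l * W + index j)"
      using w j by (auto simp: complete_def leaf_def)
    moreover have "pp j \<le> (real (index j) + 1) * grid l" "index j \<le> N"
      using index_bounds j by auto
    moreover have "grid l = 2 * B / N * 2 ^ level j" by (simp add: grid_def j)
    ultimately have "2 - w (l * W + index j) \<le> ss j" "index j \<le> N"
      "pp j \<le> real (index j) * grid l + 2 * B / N * 2 ^ level j"
      by (auto simp: distrib_right add_divide_distrib)
    then show ?case using Cons j(2)
      by (auto simp: distrib_right distrib_left add_divide_distrib simp del: times_divide_eq_left)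
  qed simp
  then show "2 ^ l * length (map index js) = (\<Sum>j\<leftarrow>js. 2 ^ level j)"
    and "set (map index js) \<subseteq> {..N}"
    and "(\<Sum>i\<leftarrow>map index js. 2 - w (l * W + i)) \<le> (\<Sum>j\<leftarrow>js. ss j)"
    and "(\<Sum>j\<leftarrow>js. pp j) \<le> real (sum_list (map index js)) * grid l
           + 2 * B / N * real (\<Sum>j\<leftarrow>js. 2 ^ level j)"
    by blast+
qed

definition upto_level :: "nat \<Rightarrow> nat list \<Rightarrow> nat list" where
  "upto_level l js = filter (\<lambda>j. level j \<le> l) js"

lemma sum_upto_level_Suc:
  fixes f :: "nat \<Rightarrow> 'a::comm_monoid_add"
  shows "(\<Sum>j\<leftarrow>upto_level (Suc l) js. f j) =
    (\<Sum>j\<leftarrow>upto_level l js. f j) + (\<Sum>j\<leftarrow>filter (\<lambda>j. level j = Suc l) js. f j)"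
  by (induction js) (auto simp: upto_level_def ac_simps)

text \<open>
  Kraft's inequality: items whose weights \<open>2 ^ level j\<close> sum to at most \<open>2 ^ K\<close> hang as leaves in one
  binary tree of height \<open>K\<close>. Going up a level halves the number of nodes, up to an unpaired one; the
  summand \<open>2 ^ l\<close> makes up for these.
\<close>

lemma pack_levels:
  assumes w: "complete w" and js: "set js \<subseteq> {..<n}" and kraft: "(\<Sum>j\<leftarrow>js. 2 ^ level j) \<le> (2::nat) ^ K"
  shows "l \<le> K \<Longrightarrow> \<exists>L. set L \<subseteq> {..N} \<and>
    2 ^ l * length L + 1 \<le> (\<Sum>j\<leftarrow>upto_level l js. 2 ^ level j) + 2 ^ l \<and>
    (\<Sum>i\<leftarrow>L. 2 - w (l * W + i)) \<le> (\<Sum>j\<leftarrow>upto_level l js. ss j) \<and>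
    (\<Sum>j\<leftarrow>upto_level l js. pp j) \<le> real (sum_list L) * grid l + 3 * l * P / N
      + 2 * B / N * real (\<Sum>j\<leftarrow>upto_level l js. 2 ^ level j)"
proof (induction l)
  case 0
  have "\<forall>j\<in>set (upto_level 0 js). level j = 0" "set (upto_level 0 js) \<subseteq> {..<n}"
    using js by (auto simp: upto_level_def)
  note * = leaves_at_level[OF w this(2,1)]
  show ?case
    by (rule exI[of _ "map index (upto_level 0 js)"]) (use * in auto)
next
  case (Suc l)
  let ?T = "\<lambda>l. (\<Sum>j\<leftarrow>upto_level l js. 2 ^ level j) :: nat"
  obtain L where L: "set L \<subseteq> {..N}" "2 ^ l * length L + 1 \<le> ?T l + 2 ^ l"
    "(\<Sum>i\<leftarrow>L. 2 - w (l * W + i)) \<le> (\<Sum>j\<leftarrow>upto_level l js. ss j)"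
    "(\<Sum>j\<leftarrow>upto_level l js. pp j) \<le> real (sum_list L) * grid l + 3 * l * P / N + 2 * B / N * real (?T l)"
    using Suc by auto
  obtain L' where L': "set L' \<subseteq> {..N}" "2 * length L' \<le> length L + 1"
    "(\<Sum>i\<leftarrow>L'. 2 - w ((l + 1) * W + i)) \<le> (\<Sum>i\<leftarrow>L. 2 - w (l * W + i))"
    "sum_list L \<le> 2 * sum_list L' + length L'"
    using pair_up[OF w Suc_le_lessD[OF Suc.prems] L(1)] by blast
  define new where "new = filter (\<lambda>j. level j = Suc l) js"
  have "set new \<subseteq> {..<n}" "\<forall>j\<in>set new. level j = Suc l" using js by (auto simp: new_def)
  note new = leaves_at_level[OF w this]
  have "?T l \<le> 2 ^ K"
  proof -
    have "?T l \<le> (\<Sum>j\<leftarrow>js. 2 ^ level j)" unfolding upto_level_def by (induction js) auto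
    then show ?thesis using kraft by simp
  qed
  moreover have "(2::nat) ^ l \<le> 2 ^ K" using Suc by simp
  moreover have len: "2 ^ l * (2 * length L') \<le> 2 ^ l * (length L + 1)"
    using L'(2) by (intro mult_left_mono) auto
  \<comment> \<open>The factor 3 collects at most \<open>2 ^ K\<close> from the weights hung in so
    far, and at most \<open>2 ^ K\<close> each from the slack \<open>2 ^ l\<close> of the induction
    hypothesis and from an unpaired node.\<close>
  ultimately have "2 ^ l * (2 * length L') \<le> 3 * (2::nat) ^ K" using L(2)
    unfolding distrib_left mult_1_right by linarith
  then have "real (2 ^ l * (2 * length L')) \<le> real (3 * 2 ^ K)" by (subst of_nat_le_iff)
  then have "(2 ^ l * (2 * real (length L'))) * (B / N) \<le> 3 * 2 ^ K * (B / N)"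
    using B_pos by (intro mult_right_mono) auto
  then have loss: "real (length L') * grid l \<le> 3 * P / N"
    by (simp add: grid_def B_def field_simps)
  have "real (sum_list L) \<le> 2 * real (sum_list L') + real (length L')"
    using L'(4) by linarith
  from mult_right_mono[OF this grid_nonneg[of l]]
  have "real (sum_list L) * grid l \<le> real (sum_list L') * (2 * grid l) + real (length L') * grid l"
    by (simp add: algebra_simps)
  moreover have "grid (Suc l) = 2 * grid l" by (simp add: grid_def)
  ultimately have prof: "(\<Sum>j\<leftarrow>upto_level l js. pp j) \<le>
      real (sum_list L') * grid (Suc l) + 3 * P / N + 3 * l * P / N + 2 * B / N * real (?T l)"
    using L(4) loss by simp
  show ?case
  proof (intro exI[of _ "L' @ map index new"] conjI)
    show "set (L' @ map index new) \<subseteq> {..N}" using L'(1) new(2) by simp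
    show "2 ^ Suc l * length (L' @ map index new) + 1 \<le> ?T (Suc l) + 2 ^ Suc l"
      using new(1) len L(2) unfolding sum_upto_level_Suc new_def[symmetric]
      by (simp add: algebra_simps)
    show "(\<Sum>i\<leftarrow>L' @ map index new. 2 - w (Suc l * W + i)) \<le> (\<Sum>j\<leftarrow>upto_level (Suc l) js. ss j)"
      using new(3) L(3) L'(3) unfolding sum_upto_level_Suc new_def[symmetric] by simp
    have "3 * real (Suc l) * P / N = 3 * P / N + 3 * l * P / N"
      by (simp add: add_divide_distrib distrib_left distrib_right)
    then show "(\<Sum>j\<leftarrow>upto_level (Suc l) js. pp j) \<le>
      real (sum_list (L' @ map index new)) * grid (Suc l) + 3 * real (Suc l) * P / N
      + 2 * B / N * real (?T (Suc l))"
      using prof new(4) unfolding sum_upto_level_Suc new_def[symmetric]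
      by (simp add: distrib_right distrib_left)
  qed
qed

lemma sum_list_replicate_concat:
  fixes f :: "nat \<Rightarrow> real"
  shows "(\<Sum>j\<leftarrow>concat (map (\<lambda>j. replicate (y j) j) [0..<m]). f j) = (\<Sum>j<m. f j * real (y j))"
  by (induction m) (auto simp: sum_list_replicate)

text \<open>
  The items of profit at most \<open>B\<close> may all be exchanged for bundles of the densest one among them, at
  the price of at most one bundle.
\<close>

lemma bundle_small:
  "\<exists>y. (\<Sum>j<n. ss j * real (y j)) \<le> usage x \<and> profit x \<le> (\<Sum>j<n. pp j * real (y j)) + 2 * B"
proof -
  define small where "small = {j. j < n \<and> p j \<le> B}"
  define large where "large = {..<n} - small"
  have fin: "finite small" "finite large" by (auto simp: small_def large_def)
  have split: "sum f {..<n} = sum f large + sum f small" for f :: "nat \<Rightarrow> real"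
    unfolding large_def by (rule sum.subset_diff) (auto simp: small_def)
  have large: "pp j = p j \<and> ss j = s j" if "j \<in> large" for j
    using copies_large[of j] that by (auto simp: large_def small_def pp_def ss_def)
  show ?thesis
  proof (cases "small = {}")
    case True
    then show ?thesis
      using large True by (intro exI[of _ x]) (simp add: usage_def profit_def split B_pos less_imp_le)
  next
    case False
    define D where "D = (\<lambda>j. p j / s j) ` small"
    have "finite D" "D \<noteq> {}" using False fin by (auto simp: D_def)
    then have D: "Max D \<in> D" "\<forall>y\<in>D. y \<le> Max D" by simp_all
    then obtain d where d: "d \<in> small" "\<forall>j\<in>small. p j / s j \<le> p d / s d"
      by (auto simp: D_def)
    have dn: "d < n" using d by (simp add: small_def)
    note pd = p_pos[OF dn] and sd = s_pos[OF dn]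
    have ppd: "pp d > 0" "pp d \<le> 2 * B"
      using pp_gt[OF dn] B_pos pp_le[OF dn] d(1) by (auto simp: small_def)
    define S where "S = (\<Sum>j\<in>small. p j * real (x j))"
    have S0: "S \<ge> 0" unfolding S_def using p_pos by (intro sum_nonneg) (auto simp: small_def less_imp_le)
    \<comment> \<open>Rounding down keeps the size within that of the small items. The profit lost
      is at most one bundle of \<open>d\<close>, hence at most \<open>2 * B\<close> because
      \<open>d\<close> is small.\<close>
    define m where "m = nat \<lfloor>S / pp d\<rfloor>"
    have m: "real m = of_int \<lfloor>S / pp d\<rfloor>" unfolding m_def using S0 ppd by simp
    have "real m \<le> S / pp d" unfolding m by linarith
    then have m1: "pp d * m \<le> S" using ppd by (simp add: field_simps)
    have "S / pp d \<le> real m + 1" unfolding m by linarith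
    then have m2: "S \<le> pp d * m + 2 * B" using ppd by (simp add: field_simps)
    define y where "y = (\<lambda>j. if j \<in> large then x j else if j = d then m else 0)"
    have y_small: "(\<Sum>j\<in>small. f j * real (y j)) = f d * m" for f :: "nat \<Rightarrow> real"
    proof -
      have "(\<Sum>j\<in>small. f j * real (y j)) = (\<Sum>j\<in>small. if j = d then f d * m else 0)"
        by (rule sum.cong) (auto simp: y_def large_def)
      then show ?thesis using fin d by simp
    qed
    have y_large: "(\<Sum>j\<in>large. f j * real (y j)) = (\<Sum>j\<in>large. f j * real (x j))" for f :: "nat \<Rightarrow> real"
      by (rule sum.cong) (auto simp: y_def)
    have "ss d * m = pp d * m * (s d / p d)" using pd by (simp add: pp_def ss_def)
    also have "\<dots> \<le> S * (s d / p d)" using m1 pd sd by (intro mult_right_mono) auto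
    also have "\<dots> \<le> (\<Sum>j\<in>small. s j * real (x j))"
      unfolding S_def sum_distrib_right
    proof (rule sum_mono)
      fix j assume j: "j \<in> small"
      then have "s j > 0" "p j / s j \<le> p d / s d" using d s_pos by (auto simp: small_def)
      then have "p j * (s d / p d) \<le> s j" using pd sd by (simp add: field_simps)
      from mult_right_mono[OF this, of "real (x j)"]
      show "p j * real (x j) * (s d / p d) \<le> s j * real (x j)" by (simp add: mult_ac)
    qed
    finally have "ss d * m \<le> (\<Sum>j\<in>small. s j * real (x j))" .
    then show ?thesis
      using m2 large
      by (intro exI[of _ y]) (simp add: usage_def profit_def split y_small y_large S_def)
  qed
qed

lemma complete_top:
  assumes w: "complete w" and x: "usage x \<le> 1"
  shows "\<exists>i\<le>N. 1 \<le> w (K * W + i) \<and> profit x \<le> real i * grid K + 4 * P / 2 ^ K"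
proof -
  obtain y where y: "(\<Sum>j<n. ss j * real (y j)) \<le> usage x"
    "profit x \<le> (\<Sum>j<n. pp j * real (y j)) + 2 * B" using bundle_small by auto
  define js where "js = concat (map (\<lambda>j. replicate (y j) j) [0..<n])"
  have js: "(\<Sum>j\<leftarrow>js. f j) = (\<Sum>j<n. f j * real (y j))" for f :: "nat \<Rightarrow> real"
    unfolding js_def by (rule sum_list_replicate_concat)
  have jsn: "set js \<subseteq> {..<n}" by (auto simp: js_def)
  \<comment> \<open>The bundles together form an ordinary solution, so their profit is at most
    \<open>P = 2 ^ K * B\<close>. As a bundle of level \<open>l\<close> contributes at least
    \<open>2 ^ l * B\<close>, Kraft's inequality follows.\<close>
  have "(\<Sum>j<n. pp j * real (y j)) \<le> P"
    using profit_le_P[of "\<lambda>j. copies j * y j"] y(1) x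
    by (simp add: profit_def usage_def pp_def ss_def mult_ac)
  then have "(\<Sum>j\<leftarrow>js. pp j) \<le> P" by (simp add: js)
  moreover have "(\<Sum>j\<leftarrow>js. 2 ^ level j * B) \<le> (\<Sum>j\<leftarrow>js. pp j)"
    using jsn level_bounds by (intro sum_list_mono) auto
  moreover have "(\<Sum>j\<leftarrow>js. 2 ^ level j * B) = real (\<Sum>j\<leftarrow>js. 2 ^ level j) * B"
    by (induction js) (auto simp: distrib_right)
  ultimately have "real (\<Sum>j\<leftarrow>js. 2 ^ level j) * B \<le> real (2 ^ K) * B" by (simp add: B_def)
  then have kraft: "(\<Sum>j\<leftarrow>js. 2 ^ level j) \<le> (2::nat) ^ K" using B_pos by (simp del: of_nat_power)
  have all: "upto_level K js = js"
    unfolding upto_level_def using jsn level_le by (intro filter_True) auto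
  obtain L where L: "set L \<subseteq> {..N}"
    "2 ^ K * length L + 1 \<le> (\<Sum>j\<leftarrow>js. 2 ^ level j) + (2::nat) ^ K"
    "(\<Sum>i\<leftarrow>L. 2 - w (K * W + i)) \<le> (\<Sum>j\<leftarrow>js. ss j)"
    "(\<Sum>j\<leftarrow>js. pp j) \<le> real (sum_list L) * grid K + 3 * K * P / N
      + 2 * B / N * real (\<Sum>j\<leftarrow>js. 2 ^ level j)"
    using pack_levels[OF w jsn kraft, of K] all by auto
  \<comment> \<open>At level \<open>K\<close> the slack \<open>2 ^ K\<close> leaves room for one
    node only: the root.\<close>
  have "2 ^ K * length L < 2 ^ K * (2::nat)" using L(2) kraft by linarith
  then have "length L < 2" by simp
  then obtain i where i: "i \<le> N" "2 - w (K * W + i) \<le> 1" "sum_list L = i"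
  proof (cases L)
    case Nil
    then show ?thesis using that[of 0] complete_zero[OF w, of K] by simp
  next
    case (Cons a L')
    then show ?thesis using that[of a] L(1,3) \<open>length L < 2\<close> js[of ss] y(1) x by simp
  qed
  have "2 * B / N * real (\<Sum>j\<leftarrow>js. 2 ^ level j) \<le> 2 * B / N * real (2 ^ K)"
    using kraft B_pos N_pos by (intro mult_left_mono, subst of_nat_le_iff) auto
  also have "\<dots> = 2 * P / N" by (simp add: B_def)
  finally have "(\<Sum>j\<leftarrow>js. pp j) \<le> real i * grid K + 3 * K * P / N + 2 * P / N"
    using L(4) i by simp
  moreover have "3 * K * P / N + 2 * P / N \<le> 2 * P / 2 ^ K"
  proof -
    have "3 * K * P / N + 2 * P / N = (3 * K + 2) * P / N"
      by (simp add: add_divide_distrib distrib_right)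
    also have "\<dots> \<le> (4 * (K + 1)) * P / N" using P_pos by (intro divide_right_mono mult_right_mono) auto
    also have "\<dots> = 2 * P / 2 ^ K"
    proof -
      have "real N = real (K + 1) * (2 * 2 ^ K)" by (simp add: N_def algebra_simps)
      moreover have "x > 0 \<Longrightarrow> t > 0 \<Longrightarrow> 4 * x * P / (x * (2 * t)) = 2 * P / t" for x t :: real
        by (simp add: field_simps)
      from this[of "real (K + 1)" "2 ^ K"]
      have "4 * real (K + 1) * P / (real (K + 1) * (2 * 2 ^ K)) = 2 * P / 2 ^ K" by simp
      ultimately show ?thesis by (simp only: of_nat_mult of_nat_numeral)
    qed
    finally show ?thesis .
  qed
  ultimately show ?thesis using i y(2) js[of pp] by (intro exI[of _ i]) (simp add: B_def)
qed

section \<open>Invariants\<close>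

text \<open>A certificate for entry \<open>q\<close>. Item numbers are shifted by one and negated,
  so that their sign tells them from table entries. Inequalities instead of equations keep a
  certificate valid when its operands improve later; operands below \<open>q\<close> with positive
  \<open>w\<close> have certificates of their own in a sound table.\<close>

definition node_ok :: "(nat \<Rightarrow> real) \<Rightarrow> (nat \<Rightarrow> real) \<Rightarrow> (nat \<Rightarrow> real) \<Rightarrow> nat \<Rightarrow> bool" where
  "node_ok w a b q \<longleftrightarrow>
     (\<exists>j<n. \<exists>r::nat. a q = - (real j + 1) \<and> b q = real r \<and>
        val q \<le> p j * r \<and> s j * r \<le> 2 - w q) \<or>
     (\<exists>u<q. \<exists>v<q. a q = real u \<and> b q = real v \<and> 0 < w u \<and> 0 < w v \<and>
        val q \<le> val u + val v \<and> (2 - w u) + (2 - w v) \<le> 2 - w q)"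

definition sound :: "(nat \<Rightarrow> real) \<Rightarrow> (nat \<Rightarrow> real) \<Rightarrow> (nat \<Rightarrow> real) \<Rightarrow> bool" where
  "sound w a b \<longleftrightarrow> (\<forall>q. 0 \<le> w q \<and> w q \<le> 2 \<and> (0 < w q \<longrightarrow> node_ok w a b q))"

text \<open>Raising \<open>w q\<close> only shrinks a recorded size, which relaxes the condition on
  every pair referring to \<open>q\<close>. So only the certificate of \<open>q\<close> itself must
  be supplied.\<close>

lemma sound_update:
  assumes sound: "sound w a b" and w': "w q < w'" "w' \<le> 2"
    and ok: "node_ok (w(q := w')) (a(q := a')) (b(q := b')) q"
  shows "sound (w(q := w')) (a(q := a')) (b(q := b'))"
  unfolding sound_def
proof (intro allI conjI impI)
  fix q'
  show "0 \<le> (w(q := w')) q'" "(w(q := w')) q' \<le> 2"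
    using sound w' unfolding sound_def by (auto intro: order_trans[OF _ less_imp_le])
  assume pos: "0 < (w(q := w')) q'"
  show "node_ok (w(q := w')) (a(q := a')) (b(q := b')) q'"
  proof (cases "q' = q")
    case True then show ?thesis using ok by simp
  next
    case False
    then have "node_ok w a b q'" using sound pos by (simp add: sound_def)
    then consider
      j r where "j < n" "a q' = - (real j + 1)" "b q' = real r" "val q' \<le> p j * r" "s j * r \<le> 2 - w q'"
    | u v where "u < q'" "v < q'" "a q' = real u" "b q' = real v" "0 < w u" "0 < w v"
        "val q' \<le> val u + val v" "(2 - w u) + (2 - w v) \<le> 2 - w q'"
      unfolding node_ok_def by blast
    then show ?thesis
    proof cases
      case (1 j r)
      then show ?thesis using False unfolding node_ok_def by auto
    next
      case (2 u v)
      have "w u \<le> (w(q := w')) u" "w v \<le> (w(q := w')) v" using w' by auto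
      with 2 False show ?thesis unfolding node_ok_def
        by (intro disjI2 exI[of _ u] exI[of _ v] conjI) auto
    qed
  qed
qed

lemma sound_leaf:
  assumes "sound w a b" "j < n" "w (leaf j) < 2 - ss j"
  shows "sound (w(leaf j := 2 - ss j)) (a(leaf j := - (real j + 1))) (b(leaf j := real (copies j)))"
proof (rule sound_update[OF assms(1,3)])
  show "2 - ss j \<le> 2" using s_pos[OF assms(2)] by (simp add: ss_def)
  show "node_ok (w(leaf j := 2 - ss j)) (a(leaf j := - (real j + 1))) (b(leaf j := real (copies j))) (leaf j)"
    unfolding node_ok_def using assms(2) val_leaf[OF assms(2)]
    by (intro disjI1 exI[of _ j] exI[of _ "copies j"]) (simp add: pp_def ss_def mult.commute)
qed

lemma sound_pair:
  assumes "sound w a b" "z < K * W * W" "w (parent z) < w (left z) + w (right z) - 2"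
  shows "sound (w(parent z := w (left z) + w (right z) - 2)) (a(parent z := real (left z)))
           (b(parent z := real (right z)))"
proof (rule sound_update[OF assms(1,3)])
  have w: "0 \<le> w q \<and> w q \<le> 2" for q using assms(1) by (simp add: sound_def)
  show "w (left z) + w (right z) - 2 \<le> 2" using w[of "left z"] w[of "right z"] by simp
  \<comment> \<open>Absent operands never win: with all values between 0 and 2, a strict improvement
    forces both operands to be positive.\<close>
  have "0 < w (left z)" "0 < w (right z)"
    using assms(3) w[of "left z"] w[of "right z"] w[of "parent z"] by linarith+
  then show "node_ok (w(parent z := w (left z) + w (right z) - 2)) (a(parent z := real (left z)))
           (b(parent z := real (right z))) (parent z)"
    unfolding node_ok_def using pair_bounds[OF assms(2)]
    by (intro disjI2 exI[of _ "left z"] exI[of _ "right z"]) auto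
qed

section \<open>Progress towards a complete table\<close>

definition pairs_done :: "nat \<Rightarrow> (nat \<Rightarrow> real) \<Rightarrow> bool" where
  "pairs_done k w \<longleftrightarrow> (\<forall>z<k. w (left z) + w (right z) - 2 \<le> w (parent z))"

definition items_done :: "nat \<Rightarrow> (nat \<Rightarrow> real) \<Rightarrow> bool" where
  "items_done k w \<longleftrightarrow> 2 \<le> w 0 \<and> (\<forall>j<k. 2 - ss j \<le> w (leaf j))"

lemma complete_iff: "complete w \<longleftrightarrow> items_done n w \<and> pairs_done (K * W * W) w"
  by (auto simp: complete_def items_done_def pairs_done_def)

lemma items_done_increase: "items_done k w \<Longrightarrow> w q \<le> w' \<Longrightarrow> items_done k (w(q := w'))"
  unfolding items_done_def by (auto intro: order_trans)

lemma items_done_Suc: "items_done k w \<Longrightarrow> 2 - ss k \<le> w (leaf k) \<Longrightarrow> items_done (Suc k) w"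
  unfolding items_done_def by (auto simp: less_Suc_eq)

lemma pairs_done_keep:
  "pairs_done z w \<Longrightarrow> w (left z) + w (right z) - 2 \<le> w (parent z) \<Longrightarrow> pairs_done (Suc z) w"
  unfolding pairs_done_def by (auto simp: less_Suc_eq)

lemma pairs_done_update:
  assumes "pairs_done z w" "w (parent z) < w (left z) + w (right z) - 2"
  shows "pairs_done (Suc z) (w(parent z := w (left z) + w (right z) - 2))"
  unfolding pairs_done_def
proof (intro allI impI)
  fix z' assume "z' < Suc z"
  then have z': "z' \<le> z" by simp
  have "w (left z') + w (right z') - 2 \<le> w (parent z') \<or> z' = z"
    using assms(1) z' by (auto simp: pairs_done_def)
  then show "(w(parent z := w (left z) + w (right z) - 2)) (left z') +
      (w(parent z := w (left z) + w (right z) - 2)) (right z') - 2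
      \<le> (w(parent z := w (left z) + w (right z) - 2)) (parent z')"
    using pair_order[OF z'] assms(2) by auto
qed

text \<open>\<open>x\<close> is the part of the solution already collected and \<open>c\<close>
  counts the entries below \<open>m\<close> still to be expanded. Size and profit are shared between
  the two. At \<open>m = 0\<close> nothing is pending, and \<open>x\<close> itself is feasible with
  profit at least \<open>V\<close>.\<close>

definition backtracked :: "(nat \<Rightarrow> real) \<Rightarrow> real \<Rightarrow> nat \<Rightarrow> (nat \<Rightarrow> nat) \<Rightarrow> (nat \<Rightarrow> nat) \<Rightarrow> bool" where
  "backtracked w V m x c \<longleftrightarrow> (\<forall>q<m. 0 < c q \<longrightarrow> 0 < w q) \<and>
     usage x + (\<Sum>q<m. real (c q) * (2 - w q)) \<le> 1 \<and>
     V \<le> profit x + (\<Sum>q<m. real (c q) * val q)"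

lemma sum_count_update:
  fixes g :: "nat \<Rightarrow> real"
  assumes "u < m"
  shows "(\<Sum>q<m. real ((c(u := c u + d)) q) * g q) = (\<Sum>q<m. real (c q) * g q) + real d * g u"
proof -
  have "(\<Sum>q<m. real ((c(u := c u + d)) q) * g q) =
      (\<Sum>q<m. real (c q) * g q + (if q = u then real d * g u else 0))"
    by (rule sum.cong) (auto simp: distrib_right)
  then show ?thesis using assms by (simp add: sum.distrib)
qed

lemma profit_update: "j < n \<Longrightarrow> profit (x(j := x j + d)) = profit x + p j * d"
  using sum_count_update[of j n x d p] by (simp add: profit_def mult.commute)

lemma usage_update: "j < n \<Longrightarrow> usage (x(j := x j + d)) = usage x + s j * d"
  using sum_count_update[of j n x d s] by (simp add: usage_def mult.commute)

lemma backtracked_zero: "backtracked w V (Suc m) x c \<Longrightarrow> c m = 0 \<Longrightarrow> backtracked w V m x c"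
  by (simp add: backtracked_def)

lemma backtracked_leaf:
  assumes "backtracked w V (Suc m) x c" "j < n" "val m \<le> p j * r" "s j * r \<le> 2 - w m"
  shows "backtracked w V m (x(j := x j + r * c m)) c"
proof -
  have "real (c m) * val m \<le> real (c m) * (p j * r)"
    "real (c m) * (s j * r) \<le> real (c m) * (2 - w m)"
    using assms by (auto intro: mult_left_mono)
  then show ?thesis using assms(1,2)
    by (auto simp: backtracked_def profit_update usage_update mult_ac)
qed

text \<open>The second update acts on \<open>c'\<close> and not on \<open>c\<close>, because
  \<open>u\<close> and \<open>v\<close> may coincide and must then be counted twice.\<close>

lemma backtracked_pair:
  assumes bt: "backtracked w V (Suc m) x c" and uv: "u < m" "v < m" "0 < w u" "0 < w v"
    "val m \<le> val u + val v" "(2 - w u) + (2 - w v) \<le> 2 - w m"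
    and c': "c' = c(u := c u + c m)"
  shows "backtracked w V m x (c'(v := c' v + c m))"
proof -
  let ?c = "c'(v := c' v + c m)"
  have s: "(\<Sum>q<m. real (?c q) * g q) = (\<Sum>q<m. real (c q) * g q) + real (c m) * (g u + g v)"
    for g :: "nat \<Rightarrow> real"
    unfolding sum_count_update[OF uv(2)] c' sum_count_update[OF uv(1)] by (simp add: distrib_left)
  have "real (c m) * val m \<le> real (c m) * (val u + val v)"
    "real (c m) * ((2 - w u) + (2 - w v)) \<le> real (c m) * (2 - w m)"
    using uv by (auto intro!: mult_left_mono)
  moreover have "\<forall>q<m. 0 < ?c q \<longrightarrow> 0 < w q"
    using bt uv unfolding backtracked_def c' by (auto simp: less_Suc_eq)
  ultimately show ?thesis using bt unfolding backtracked_def s by simp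
qed

end

section \<open>The program\<close>

text \<open>
  Registers: 0 \<open>n\<close>, 1 \<open>\<epsilon>\<close>, 2 one, 3 two, 4 four, 5 \<open>2 * B\<close>, 6 \<open>K\<close>, 7 \<open>K + 1\<close>, 8 \<open>2 * n\<close>, 9 the base
  address of the table, 10 zero, 11 \<open>P\<close>, 12 a power of 2, 13 the loop counter, 14 a loop bound,
  15 \<open>N\<close>, 16 \<open>W\<close>, 17 \<open>Q\<close>, 18 \<open>B\<close>, 19 the best index found at level \<open>K\<close>; those from 20 on are temporary.
  The address \<open>2 * n + l\<close> with \<open>l \<le> K\<close> holds \<open>2 ^ l\<close>. Entry \<open>q = l * W + i\<close> of the table has four
  fields: 0 is \<open>2\<close> minus the size (so the initial \<open>0\<close> means an absent entry); 1 and 2 are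
  \<open>-(j + 1)\<close> and the number of copies for an item \<open>j\<close>, or else the two entries of a pair;
  3 is the multiplicity used in the backtracking.
\<close>

definition item_body :: prog where
  "item_body =
     Load 20 13 ;; Assign 21 (Add 0 13) ;; Load 21 21 ;;
     Assign 22 (Div 18 20) ;; Assign 22 (Floor 22) ;; Assign 22 (Add 22 2) ;;
     Assign 20 (Mul 22 20) ;; Assign 21 (Mul 22 21) ;; Assign 21 (Sub 3 21) ;;
     Assign 23 (Div 20 18) ;; Assign 23 (Log 23) ;; Assign 23 (Floor 23) ;;
     Assign 24 (Add 8 23) ;; Load 24 24 ;; Assign 24 (Mul 5 24) ;;
     Assign 25 (Mul 20 15) ;; Assign 25 (Div 25 24) ;; Assign 25 (Floor 25) ;;
     Assign 26 (Mul 23 16) ;; Assign 26 (Add 26 25) ;;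
     Assign 26 (Mul 4 26) ;; Assign 26 (Add 9 26) ;; Load 27 26 ;;
     If (Less 27 21)
       (Store 26 21 ;;
        Assign 27 (Add 26 2) ;; Assign 28 (Add 13 2) ;; Assign 28 (Sub 10 28) ;; Store 27 28 ;;
        Assign 27 (Add 26 3) ;; Store 27 22)
       Skip ;;
     Assign 13 (Add 13 2)"

text \<open>There is no remainder operation: the loop counter is decoded by division, rounding down
  and subtraction. Registers 20, 21 and 22 end up holding \<open>left\<close>, \<open>right\<close>
  and \<open>parent\<close>.\<close>

definition pair_body :: prog where
  "pair_body =
     Assign 20 (Div 13 16) ;; Assign 20 (Floor 20) ;;
     Assign 21 (Mul 20 16) ;; Assign 21 (Sub 13 21) ;;
     Assign 22 (Div 20 16) ;; Assign 22 (Floor 22) ;; Assign 22 (Mul 22 16) ;;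
     Assign 23 (Sub 20 22) ;; Assign 23 (Add 23 21) ;; Assign 23 (Div 23 3) ;; Assign 23 (Floor 23) ;;
     Assign 21 (Add 22 21) ;;
     Assign 22 (Add 22 16) ;; Assign 22 (Add 22 23) ;;
     Assign 23 (Mul 4 20) ;; Assign 23 (Add 9 23) ;; Load 23 23 ;;
     Assign 24 (Mul 4 21) ;; Assign 24 (Add 9 24) ;; Load 24 24 ;;
     Assign 23 (Add 23 24) ;; Assign 23 (Sub 23 3) ;;
     Assign 25 (Mul 4 22) ;; Assign 25 (Add 9 25) ;; Load 26 25 ;;
     If (Less 26 23)
       (Store 25 23 ;;
        Assign 26 (Add 25 2) ;; Store 26 20 ;;
        Assign 26 (Add 25 3) ;; Store 26 21)
       Skip ;;
     Assign 13 (Add 13 2)"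

text \<open>Tests compare registers: \<open>LessEq 2 20\<close> asks whether 1, the content of
  register 2, is at most the entry, that is, whether the recorded size fits the capacity. As indices
  are scanned upwards, the last hit is the largest.\<close>

definition best_body :: prog where
  "best_body =
     Assign 20 (Mul 6 16) ;; Assign 20 (Add 20 13) ;; Assign 20 (Mul 4 20) ;; Assign 20 (Add 9 20) ;;
     Load 20 20 ;;
     If (LessEq 2 20) (Assign 19 (Reg 13)) Skip ;;
     Assign 13 (Add 13 2)"

text \<open>The solution is accumulated in the cells of the profits, which are not read again once
  the items have been entered in the table.\<close>

definition clear_body :: prog where
  "clear_body = Store 13 10 ;; Assign 13 (Add 13 2)"

text \<open>Register 29 holds 3, the offset of the multiplicity field. A negative first field
  signals an item. For a pair, the second multiplicity is loaded only after the first has been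
  stored, which is correct also for two equal operands.\<close>

definition back_body :: prog where
  "back_body =
     Assign 29 (Add 2 3) ;;
     Assign 20 (Sub 17 2) ;; Assign 20 (Sub 20 13) ;;
     Assign 21 (Mul 4 20) ;; Assign 21 (Add 9 21) ;;
     Assign 22 (Add 21 2) ;; Load 22 22 ;;
     Assign 23 (Add 21 3) ;; Load 23 23 ;;
     Assign 24 (Add 21 29) ;; Load 24 24 ;;
     If (Less 10 24)
       (If (Less 22 10)
          (Assign 22 (Add 22 2) ;; Assign 22 (Sub 10 22) ;;
           Load 25 22 ;; Assign 24 (Mul 23 24) ;; Assign 25 (Add 25 24) ;; Store 22 25)
          (Assign 22 (Mul 4 22) ;; Assign 22 (Add 9 22) ;; Assign 22 (Add 22 29) ;;
           Load 25 22 ;; Assign 25 (Add 25 24) ;; Store 22 25 ;;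
           Assign 23 (Mul 4 23) ;; Assign 23 (Add 9 23) ;; Assign 23 (Add 23 29) ;;
           Load 25 23 ;; Assign 25 (Add 25 24) ;; Store 23 25))
       Skip ;;
     Assign 13 (Add 13 2)"

text \<open>Used against the usual direction, with the distributing rules removed: an address must
  be gathered into a single \<open>real i\<close> before \<open>address_of_nat\<close> can evaluate
  it.\<close>

lemmas fold_of_nat = of_nat_add[symmetric] of_nat_mult[symmetric] of_nat_Suc[symmetric]

lemma real_plus_1: "real a + 1 = real (Suc a)"
  by simp

lemmas nat_real = fold_of_nat real_plus_1

lemma real_mod_nat: "real k - real (k div W * W) = real (k mod W)"
  by (metis add_diff_cancel_left' div_mult_mod_eq of_nat_add)

section \<open>Memory layout and correctness of the loop bodies\<close>

context ukp_rounding
begin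

definition Q :: nat where "Q = (K + 1) * W"
definition base :: nat where "base = n + n + (K + 1)"
definition cell :: "nat \<Rightarrow> nat \<Rightarrow> nat" where "cell f q = base + 4 * q + f"
definition field :: "nat \<Rightarrow> (nat \<Rightarrow> real) \<Rightarrow> nat \<Rightarrow> real" where "field f M q = M (cell f q)"
definition memory :: nat where "memory = base + 4 * Q"

lemma cell_eq_iff: "f < 4 \<Longrightarrow> g < 4 \<Longrightarrow> cell f q = cell g q' \<longleftrightarrow> f = g \<and> q = q'"
  unfolding cell_def by presburger

lemma field_update: "f < 4 \<Longrightarrow> g < 4 \<Longrightarrow>
    field f (M(cell g q := v)) = (if f = g then (field f M)(q := v) else field f M)"
  by (auto simp: field_def cell_eq_iff fun_eq_iff)

lemma field_update_low: "i < base \<Longrightarrow> field f (M(i := v)) = field f M"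
  by (auto simp: field_def cell_def fun_eq_iff)

lemma low_update_cell: "i < base \<Longrightarrow> (M(cell f q := v)) i = M i"
  by (auto simp: cell_def)

lemma cell_less: "q < Q \<Longrightarrow> f < 4 \<Longrightarrow> cell f q < memory"
  by (simp add: cell_def memory_def)

lemma low_less: "i < base \<Longrightarrow> i < memory"
  by (simp add: memory_def)

lemma cell_address:
  "real base + 4 * real q = real (cell 0 q)"
  "real (cell 0 q) + 1 = real (cell 1 q)"
  "real (cell 0 q) + 2 = real (cell 2 q)"
  "real (cell 0 q) + 3 = real (cell 3 q)"
  "Suc (cell 0 q) = cell 1 q"
  by (simp_all add: cell_def)

definition env :: "(nat \<Rightarrow> real) \<Rightarrow> bool" where
  "env R \<longleftrightarrow> R 0 = real n \<and> R 2 = 1 \<and> R 3 = 2 \<and> R 4 = 4 \<and> R 6 = real K \<and> R 7 = real (K + 1) \<and>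
     R 8 = real (n + n) \<and> R 9 = real base \<and> R 10 = 0 \<and> R 11 = P"

definition env' :: "(nat \<Rightarrow> real) \<Rightarrow> bool" where
  "env' R \<longleftrightarrow> env R \<and> R 5 = 2 * B \<and> R 15 = real N \<and> R 16 = real W \<and> R 17 = real Q \<and> R 18 = B"

lemma env_update: "r \<notin> {0, 2, 3, 4, 6, 7, 8, 9, 10, 11} \<Longrightarrow> env (R(r := v)) = env R"
  by (simp add: env_def)

lemma env'_update: "r \<notin> {0, 2, 3, 4, 5, 6, 7, 8, 9, 10, 11, 15, 16, 17, 18} \<Longrightarrow> env' (R(r := v)) = env' R"
  by (simp add: env'_def env_update)

lemma env'D:
  assumes "env' R"
  shows "R 0 = real n" "R 2 = 1" "R 3 = 2" "R 4 = 4" "R 6 = real K" "R 7 = real (K + 1)"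
    "R 8 = real (n + n)" "R 9 = real base" "R 10 = 0" "R 11 = P" "R 5 = 2 * B" "R 15 = real N"
    "R 16 = real W" "R 17 = real Q" "R 18 = B"
  using assms by (auto simp: env'_def env_def)

definition item_inv :: "nat \<Rightarrow> assn" where
  "item_inv k R M \<longleftrightarrow> env' R \<and> R 13 = real k \<and> (\<forall>j<n. M j = p j \<and> M (n + j) = s j) \<and>
     (\<forall>l\<le>K. M (n + n + l) = 2 ^ l) \<and> sound (field 0 M) (field 1 M) (field 2 M) \<and>
     items_done k (field 0 M) \<and> (\<forall>q. field 3 M q = 0)"

lemma item_step:
  assumes k: "k < n" and inv: "item_inv k R M"
  shows "wp item_body memory (item_inv (Suc k)) R M"
proof -
  have env: "env' R" "R 13 = real k" using inv by (auto simp: item_inv_def)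
  note R = env'D[OF env(1)] env(2)
  have M: "M k = p k" "M (n + k) = s k" "M (n + n + level k) = 2 ^ level k"
    using inv k level_le[OF k] by (auto simp: item_inv_def)
  have pos: "p k \<noteq> 0" "B \<noteq> 0" "pp k / B > 0" using p_pos[OF k] B_pos pp_gt[OF k] by auto
  have addr: "k < memory" "n + k < memory" "n + n + level k < memory"
    using k level_le[OF k] by (auto intro!: low_less simp: base_def)
  have cells: "cell 0 (leaf k) < memory" "cell 1 (leaf k) < memory" "cell 2 (leaf k) < memory"
    using leaf_less[OF k] by (auto intro!: cell_less simp: Q_def)
  \<comment> \<open>These equations let the symbolic execution recognise the abstract quantities in
    the contents of the registers. The other loop bodies with nontrivial arithmetic follow the same
    scheme.\<close>
  have comp: "of_int \<lfloor>B / p k\<rfloor> + 1 = real (copies k)" "real (copies k) * p k = pp k"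
    "real (copies k) * s k = ss k" "of_int \<lfloor>log 2 (pp k / B)\<rfloor> = real (level k)"
    "of_int \<lfloor>pp k * N / (2 * B * 2 ^ level k)\<rfloor> = real (index k)"
    "level k * W + index k = leaf k"
    using of_nat_copies[OF k] level_bounds(1)[OF k] index_bounds(1)[OF k]
    by (simp_all add: pp_def ss_def leaf_def)
  have lt_field: "M (cell f q) = field f M q" for f q by (simp add: field_def)
  let ?M = "M(cell 0 (leaf k) := 2 - ss k, cell 1 (leaf k) := - real (Suc k),
      cell 2 (leaf k) := real (copies k))"
  have low: "?M i = M i" if "i < base" for i
    using that by (simp only: low_update_cell)
  have fields: "field 0 ?M = (field 0 M)(leaf k := 2 - ss k)"
    "field 1 ?M = (field 1 M)(leaf k := - (real k + 1))"
    "field 2 ?M = (field 2 M)(leaf k := real (copies k))" "field 3 ?M = field 3 M"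
    by (simp_all add: field_update fun_eq_iff)
  have step: "item_inv (Suc k) R' ?M"
    if "env' R'" "R' 13 = real (Suc k)" "field 0 M (leaf k) < 2 - ss k" for R'
    unfolding item_inv_def fields
  proof (intro conjI allI impI)
    fix l assume "l \<le> K"
    then show "?M (n + n + l) = 2 ^ l" using inv by (subst low) (auto simp: base_def item_inv_def)
  next
    fix j assume "j < n"
    then show "?M j = p j" "?M (n + j) = s j"
      using inv by (subst low; auto simp: base_def item_inv_def)+
  next
    show "items_done (Suc k) ((field 0 M)(leaf k := 2 - ss k))"
      using inv that(3) by (intro items_done_Suc items_done_increase) (auto simp: item_inv_def)
  next
    show "sound ((field 0 M)(leaf k := 2 - ss k)) ((field 1 M)(leaf k := - (real k + 1)))
        ((field 2 M)(leaf k := real (copies k)))"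
      using inv that(3) k by (intro sound_leaf) (auto simp: item_inv_def)
  qed (use that inv in \<open>simp_all add: item_inv_def\<close>)
  have keep: "item_inv (Suc k) R' M"
    if "env' R'" "R' 13 = real (Suc k)" "\<not> field 0 M (leaf k) < 2 - ss k" for R'
    using that inv items_done_Suc[of k "field 0 M"] by (simp add: item_inv_def)
  show ?thesis
    unfolding item_body_def
    by (simp add: R M pos addr comp cells cell_address nat_real
        lt_field env env'_update step keep del: of_nat_add of_nat_mult of_nat_Suc One_nat_def)
qed

definition pair_inv :: "nat \<Rightarrow> assn" where
  "pair_inv k R M \<longleftrightarrow> env' R \<and> R 13 = real k \<and> R 14 = real (K * W * W) \<and>
     sound (field 0 M) (field 1 M) (field 2 M) \<and>
     items_done n (field 0 M) \<and> pairs_done k (field 0 M) \<and> (\<forall>q. field 3 M q = 0)"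

lemma pair_step:
  assumes k: "k < K * W * W" and inv: "pair_inv k R M"
  shows "wp pair_body memory (pair_inv (Suc k)) R M"
proof -
  have env: "env' R" "R 13 = real k" "R 14 = real (K * W * W)" using inv by (auto simp: pair_inv_def)
  note R = env'D[OF env(1)] env(2)
  have W0: "W \<noteq> 0" using W_pos by simp
  have lt: "left k < Q" "right k < Q" "parent k < Q"
    using pair_bounds[OF k] by (auto simp: Q_def)
  have cells: "cell f (left k) < memory" "cell f (right k) < memory" "cell f (parent k) < memory"
    if "f < 4" for f using lt that by (auto intro!: cell_less)
  have comp: "of_int \<lfloor>real k / real W\<rfloor> = real (left k)" "real k - real (left k * W) = real (k mod W)"
    "of_int \<lfloor>real (left k) / real W\<rfloor> = real (left k div W)"
    "real (left k) - real (left k div W * W) = real (left k mod W)"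
    "of_int \<lfloor>real (left k mod W + k mod W) / 2\<rfloor> = real ((left k mod W + k mod W) div 2)"
    "left k div W * W + k mod W = right k"
    "left k div W * W + W + (left k mod W + k mod W) div 2 = parent k"
    using floor_divide_of_nat_eq[where ?'a = real, of k W] floor_divide_of_nat_eq[where ?'a = real, of "left k" W]
      floor_divide_of_nat_eq[where ?'a = real, of "left k mod W + k mod W" 2]
    by (simp_all add: left_def right_def parent_def real_mod_nat del: of_nat_add of_nat_mult)
  have lt_field: "M (cell f q) = field f M q" for f q by (simp add: field_def)
  let ?w = "field 0 M (left k) + field 0 M (right k) - 2"
  have step: "pair_inv (Suc k) R' (M(cell 0 (parent k) := ?w, cell 1 (parent k) := real (left k),
      cell 2 (parent k) := real (right k)))"
    if "env' R'" "R' 13 = real (Suc k)" "R' 14 = real (K * W * W)" "field 0 M (parent k) < ?w" for R'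
    using that inv sound_pair[OF _ k, of "field 0 M" "field 1 M" "field 2 M"]
      items_done_increase[of n "field 0 M" "parent k" ?w] pairs_done_update[of k "field 0 M"]
    by (simp add: pair_inv_def field_update)
  have keep: "pair_inv (Suc k) R' M"
    if "env' R'" "R' 13 = real (Suc k)" "R' 14 = real (K * W * W)" "\<not> field 0 M (parent k) < ?w" for R'
    using that inv pairs_done_keep[of k "field 0 M"] by (simp add: pair_inv_def)
  show ?thesis
    unfolding pair_body_def
    by (simp add: R comp W0 cells cell_address nat_real
        lt_field env env'_update step keep del: of_nat_add of_nat_mult of_nat_Suc One_nat_def)
qed

definition best_inv :: "nat \<Rightarrow> assn" where
  "best_inv k R M \<longleftrightarrow> env' R \<and> R 13 = real k \<and>
     sound (field 0 M) (field 1 M) (field 2 M) \<and> complete (field 0 M) \<and> (\<forall>q. field 3 M q = 0) \<and>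
     (\<exists>i\<le>N. R 19 = real i \<and> 1 \<le> field 0 M (K * W + i) \<and>
       (\<forall>i'<k. 1 \<le> field 0 M (K * W + i') \<longrightarrow> i' \<le> i))"

lemma best_step:
  assumes k: "k < W" and inv: "best_inv k R M"
  shows "wp best_body memory (best_inv (Suc k)) R M"
proof -
  have env: "env' R" "R 13 = real k" using inv by (auto simp: best_inv_def)
  note R = env'D[OF env(1)] env(2)
  have kN: "k \<le> N" using k by (simp add: W_def)
  have cells: "cell 0 (K * W + k) < memory" using k by (auto intro!: cell_less simp: Q_def)
  have lt_field: "M (cell f q) = field f M q" for f q by (simp add: field_def)
  have step: "best_inv (Suc k) R' M"
    if "env' R'" "R' 13 = real (Suc k)" "R' 19 = real k" "1 \<le> field 0 M (K * W + k)" for R'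
    using that inv kN by (auto simp: best_inv_def intro!: exI[of _ k])
  have keep: "best_inv (Suc k) R' M"
    if "env' R'" "R' 13 = real (Suc k)" "R' 19 = R 19" "\<not> 1 \<le> field 0 M (K * W + k)" for R'
    using that inv by (auto simp: best_inv_def less_Suc_eq)
  show ?thesis
    unfolding best_body_def
    by (simp add: R cells cell_address nat_real
        lt_field env env'_update step keep del: of_nat_add of_nat_mult of_nat_Suc One_nat_def)
qed

text \<open>The clearing loop reuses the counter register, so the invariant of the preceding loop is
  stated with that register reset to its final value.\<close>

definition clear_inv :: "nat \<Rightarrow> assn" where
  "clear_inv k R M \<longleftrightarrow> best_inv W (R(13 := real W)) M \<and> R 13 = real k \<and> (\<forall>j<k. M j = 0)"

lemma clear_step:
  assumes k: "k < n" and inv: "clear_inv k R M"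
  shows "wp clear_body memory (clear_inv (Suc k)) R M"
proof -
  have env: "env' R" "R 13 = real k" using inv by (auto simp: clear_inv_def best_inv_def env'_update)
  note R = env'D[OF env(1)] env(2)
  have "k < base" using k by (simp add: base_def)
  then have "k < memory" by (rule low_less)
  have "clear_inv (Suc k) (R(13 := real (Suc k))) (M(k := 0))"
    using inv \<open>k < base\<close> by (auto simp: clear_inv_def best_inv_def field_update_low less_Suc_eq)
  then show ?thesis
    unfolding clear_body_def
    by (simp add: R \<open>k < memory\<close> nat_real del: of_nat_add of_nat_mult of_nat_Suc One_nat_def)
qed

definition back_inv :: "real \<Rightarrow> nat \<Rightarrow> assn" where
  "back_inv V k R M \<longleftrightarrow> env' R \<and> R 13 = real k \<and>
     sound (field 0 M) (field 1 M) (field 2 M) \<and>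
     (\<exists>x c. (\<forall>j<n. M j = real (x j)) \<and> (\<forall>q. field 3 M q = real (c q)) \<and>
        backtracked (field 0 M) V (Q - k) x c)"

lemma back_invI:
  assumes "env' R" "R 13 = real k" "sound (field 0 M) (field 1 M) (field 2 M)"
    "\<And>j. j < n \<Longrightarrow> M j = real (x j)" "\<And>q. field 3 M q = real (c q)"
    "backtracked (field 0 M) V (Q - k) x c"
  shows "back_inv V k R M"
  using assms unfolding back_inv_def by blast

lemma back_step:
  assumes k: "k < Q" and inv: "back_inv V k R M"
  shows "wp back_body memory (back_inv V (Suc k)) R M"
proof -
  have env: "env' R" "R 13 = real k" using inv by (auto simp: back_inv_def)
  note R = env'D[OF env(1)] env(2)
  \<comment> \<open>Loops count upwards whereas the table is expanded from its top: step
    \<open>k\<close> treats entry \<open>Q - 1 - k\<close>.\<close>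
  define m where "m = Q - Suc k"
  have m: "m < Q" "Q - k = Suc m" "real Q - 1 - real k = real m" using k by (auto simp: m_def)
  obtain x c where xc: "\<And>j. j < n \<Longrightarrow> M j = real (x j)" "\<And>q. field 3 M q = real (c q)"
    "backtracked (field 0 M) V (Suc m) x c"
    using inv m(2) by (auto simp: back_inv_def)
  have sound: "sound (field 0 M) (field 1 M) (field 2 M)" using inv by (simp add: back_inv_def)
  have cells: "cell f q < memory" if "q \<le> m" "f < 4" for f q
    using that m by (auto intro!: cell_less)
  have cell3: "real base + 4 * real q + 3 = real (cell 3 q)" for q
    by (simp add: cell_def)
  have lt_field: "M (cell f q) = field f M q" for f q by (simp add: field_def)
  show ?thesis
  proof (cases "c m = 0")
    case True
    have "back_inv V (Suc k) R' M" if "env' R'" "R' 13 = real (Suc k)" for R'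
      using that sound xc(1,2) backtracked_zero[OF xc(3) True]
      by (intro back_invI[where x = x and c = c]) (simp_all add: m_def)
    then show ?thesis
      unfolding back_body_def
      by (simp add: R m cells cell_address nat_real True xc
        lt_field env env'_update del: of_nat_add of_nat_mult of_nat_Suc One_nat_def)
  next
    case False
    then have "node_ok (field 0 M) (field 1 M) (field 2 M) m"
      using sound xc(3) by (auto simp: sound_def backtracked_def)
    then consider
      j r where "j < n" "field 1 M m = - (real j + 1)" "field 2 M m = real r" "val m \<le> p j * r"
        "s j * r \<le> 2 - field 0 M m"
    | u v where "u < m" "v < m" "field 1 M m = real u" "field 2 M m = real v"
        "0 < field 0 M u" "0 < field 0 M v"
        "val m \<le> val u + val v" "(2 - field 0 M u) + (2 - field 0 M v) \<le> 2 - field 0 M m"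
      unfolding node_ok_def by blast
    then show ?thesis
    proof cases
      case (1 j r)
      have j: "j < base" "j < memory" using 1(1) low_less by (auto simp: base_def)
      have "back_inv V (Suc k) R' (M(j := real (x j + r * c m)))"
        if "env' R'" "R' 13 = real (Suc k)" for R'
        using that sound xc(1,2) backtracked_leaf[OF xc(3) 1(1,4,5)] j
        by (intro back_invI[where x = "x(j := x j + r * c m)" and c = c])
          (simp_all add: m_def field_update_low)
      moreover have pred: "real (Suc j) - 1 = real j" by simp
      ultimately show ?thesis
        unfolding back_body_def
        by (simp add: pred R m cells cell_address nat_real False xc 1 j
            lt_field env env'_update del: of_nat_add of_nat_mult of_nat_Suc One_nat_def)
    next
      case (2 u v)
      define c' where "c' = c(u := c u + c m)"
      define M' where "M' = M(cell 3 u := real (c' u))"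
      have f3: "M' (cell 3 v) = real (c' v)"
        by (simp add: M'_def c'_def cell_eq_iff lt_field xc)
      have "back_inv V (Suc k) R' (M'(cell 3 v := real (c' v + c m)))"
        if "env' R'" "R' 13 = real (Suc k)" for R'
      proof (rule back_invI[where x = x and c = "c'(v := c' v + c m)"])
        show "(M'(cell 3 v := real (c' v + c m))) j = real (x j)" if "j < n" for j
          unfolding M'_def using that xc(1) by (subst low_update_cell, simp add: base_def)+ simp
        show "field 3 (M'(cell 3 v := real (c' v + c m))) q = real ((c'(v := c' v + c m)) q)" for q
          by (simp add: M'_def field_update c'_def xc(2))
        have "field f (M'(cell 3 v := real (c' v + c m))) = field f M" if "f < 3" for f
          using that by (simp add: M'_def field_update)
        then show "sound (field 0 (M'(cell 3 v := real (c' v + c m))))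
            (field 1 (M'(cell 3 v := real (c' v + c m)))) (field 2 (M'(cell 3 v := real (c' v + c m))))"
          "backtracked (field 0 (M'(cell 3 v := real (c' v + c m)))) V (Q - Suc k) x (c'(v := c' v + c m))"
          using sound backtracked_pair[OF xc(3) 2(1,2,5-8) c'_def] by (simp_all add: m_def)
      qed (use that in auto)
      moreover have "field 3 M u + real (c m) = real (c' u)" by (simp add: xc c'_def)
      moreover have "cell 3 u < memory" "cell 3 v < memory" using cells 2(1,2) by simp_all
      ultimately show ?thesis
        unfolding back_body_def
        by (simp add: R m cells cell_address cell3 nat_real False xc(1,3) xc(2)[of m] 2 M'_def[symmetric] f3
            lt_field env env'_update del: of_nat_add of_nat_mult of_nat_Suc One_nat_def)
    qed
  qed
qed

end

text \<open>No instruction exponentiates. The powers of 2 are tabulated by doubling, so that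
  \<open>item_body\<close> can look up \<open>2 ^ level\<close> in one step.\<close>

definition power_body :: prog where
  "power_body =
     Assign 20 (Add 8 13) ;; Store 20 12 ;; Assign 12 (Add 12 12) ;; Assign 13 (Add 13 2)"

text \<open>Register 12 has reached \<open>2 ^ (K + 1)\<close>, hence the doubling that yields
  \<open>B\<close>. Entry 0 is seeded with size 0 and certificate -1 with count 0: the empty
  multiset is item 0 taken zero times.\<close>

definition prepare_prog :: prog where
  "prepare_prog =
     Assign 15 (Mul 7 12) ;; Assign 16 (Add 15 2) ;; Assign 17 (Mul 7 16) ;;
     Assign 18 (Div 11 12) ;; Assign 18 (Add 18 18) ;; Assign 5 (Add 18 18) ;;
     Store 9 3 ;; Assign 20 (Add 9 2) ;; Assign 21 (Sub 10 2) ;; Store 20 21 ;;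
     Assign 13 (Reg 10)"

definition mark_prog :: prog where
  "mark_prog =
     Assign 20 (Mul 6 16) ;; Assign 20 (Add 20 19) ;; Assign 20 (Mul 4 20) ;; Assign 20 (Add 9 20) ;;
     Assign 21 (Add 2 3) ;; Assign 20 (Add 20 21) ;; Store 20 2 ;; Assign 13 (Reg 10)"

definition solve_prog :: prog where
  "solve_prog =
     (Assign 13 (Reg 10) ;; Assign 12 (Reg 2)) ;; While (Less 13 7) power_body ;;
     prepare_prog ;; While (Less 13 0) item_body ;;
     (Assign 13 (Reg 10) ;; Assign 14 (Mul 6 16) ;; Assign 14 (Mul 14 16)) ;;
     While (Less 13 14) pair_body ;;
     (Assign 13 (Reg 10) ;; Assign 19 (Reg 10)) ;; While (Less 13 16) best_body ;;
     Assign 13 (Reg 10) ;; While (Less 13 0) clear_body ;;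
     mark_prog ;; While (Less 13 17) back_body"

context ukp_rounding
begin

definition power_inv :: "nat \<Rightarrow> assn" where
  "power_inv k R M \<longleftrightarrow> env R \<and> R 13 = real k \<and> R 12 = 2 ^ k \<and>
     (\<forall>j<n. M j = p j \<and> M (n + j) = s j) \<and> (\<forall>l<k. M (n + n + l) = 2 ^ l) \<and> (\<forall>i\<ge>base. M i = 0)"

lemma power_step:
  assumes k: "k < K + 1" and inv: "power_inv k R M"
  shows "wp power_body memory (power_inv (Suc k)) R M"
proof -
  have env: "env R" "R 13 = real k" "R 12 = 2 ^ k" using inv by (auto simp: power_inv_def)
  then have R: "R 2 = 1" "R 8 = real (n + n)" by (auto simp: env_def)
  have addr: "n + n + k < base" "n + n + k < memory" using k by (auto intro!: low_less simp: base_def)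
  have "power_inv (Suc k) R' (M(n + n + k := 2 ^ k))"
    if "env R'" "R' 13 = real (Suc k)" "R' 12 = 2 ^ Suc k" for R'
    using that inv addr by (auto simp: power_inv_def less_Suc_eq)
  then show ?thesis
    unfolding power_body_def
    by (simp add: R env env_update addr nat_real del: of_nat_add of_nat_mult of_nat_Suc One_nat_def)
qed

lemma prepare_correct:
  assumes inv: "power_inv (K + 1) R M"
  shows "wp prepare_prog memory (item_inv 0) R M"
proof -
  have env: "env R" "R 12 = 2 ^ (K + 1)" "R 11 = P" using inv by (auto simp: power_inv_def env_def)
  then have R: "R 2 = 1" "R 3 = 2" "R 7 = real (K + 1)" "R 9 = real (cell 0 0)" "R 10 = 0"
    by (auto simp: env_def cell_def)
  have "cell f 0 < memory" if "f < 4" for f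
    using that W_pos by (intro cell_less) (simp_all add: Q_def)
  then have cells: "cell 0 0 < memory" "cell 1 0 < memory" by simp_all
  have comp: "real (K + 1) * 2 ^ (K + 1) = real N" "real N + 1 = real W"
    "real (K + 1) * real W = real Q" "2 * P / 2 ^ (K + 1) = B"
    by (simp_all add: N_def W_def Q_def B_def algebra_simps)
  let ?M = "M(cell 0 0 := 2, cell 1 0 := - 1)"
  have low: "?M i = M i" if "i < base" for i
    using that by (simp only: low_update_cell)
  have M0: "field f M q = 0" for f q
    using inv by (simp add: field_def cell_def power_inv_def)
  have fields: "field 0 ?M q = (if q = 0 then 2 else 0)" "field 1 ?M q = (if q = 0 then - 1 else 0)"
    "field 2 ?M q = 0" "field 3 ?M q = 0" for q
    using M0 by (simp_all add: field_update)
  have "val 0 = 0" by (simp add: val_def)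
  then have "sound (field 0 ?M) (field 1 ?M) (field 2 ?M)"
    using n_pos unfolding sound_def node_ok_def fields
    by (auto intro!: exI[of _ "0::nat"])
  moreover have "items_done 0 (field 0 ?M)" "\<forall>q. field 3 ?M q = 0"
    unfolding items_done_def fields by simp_all
  ultimately have "item_inv 0 R' ?M" if "env' R'" "R' 13 = 0" for R'
    unfolding item_inv_def using that inv low
    by (auto simp: base_def power_inv_def simp del: fun_upd_apply)
  then show ?thesis
    unfolding prepare_prog_def
    by (simp add: R env env_update comp cells cell_address env'_def del: of_nat_add of_nat_Suc One_nat_def)
qed

text \<open>The near-optimality bound is extracted here because it mentions neither registers nor
  memory and so survives the last loop unchanged. The marked index is the largest that fits, hence
  at least the one given by \<open>complete_top\<close>.\<close>

lemma mark_correct: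
  assumes inv: "clear_inv n R M"
  shows "wp mark_prog memory (\<lambda>R M. \<exists>i\<le>N. back_inv (real i * grid K) 0 R M \<and>
           (\<forall>x. usage x \<le> 1 \<longrightarrow> profit x \<le> real i * grid K + 4 * P / 2 ^ K)) R M"
proof -
  have inv': "env' R" "R 13 = real n" "sound (field 0 M) (field 1 M) (field 2 M)"
    "complete (field 0 M)" "\<And>q. field 3 M q = 0" "\<And>j. j < n \<Longrightarrow> M j = 0"
    using inv by (auto simp: clear_inv_def best_inv_def env'_update)
  obtain i where i: "i \<le> N" "R 19 = real i" "1 \<le> field 0 M (K * W + i)"
    "\<And>i'. i' < W \<Longrightarrow> 1 \<le> field 0 M (K * W + i') \<Longrightarrow> i' \<le> i"
    using inv by (auto simp: clear_inv_def best_inv_def)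
  note R = env'D[OF inv'(1)] inv'(2) i(2)
  let ?q = "K * W + i"
  have q: "?q < Q" using node_less[of K i] i by (simp add: Q_def)
  then have cells: "cell 3 ?q < memory" by (intro cell_less) auto
  have opt: "profit x \<le> real i * grid K + 4 * P / 2 ^ K" if x: "usage x \<le> 1" for x
  proof -
    obtain i' where i': "i' \<le> N" "1 \<le> field 0 M (K * W + i')"
      "profit x \<le> real i' * grid K + 4 * P / 2 ^ K"
      using complete_top[OF inv'(4) x] by auto
    then have "i' \<le> i" using i(4) by (simp add: W_def)
    then have "real i' * grid K \<le> real i * grid K" using grid_nonneg by (intro mult_right_mono) auto
    then show ?thesis using i'(3) by simp
  qed
  let ?M = "M(cell 3 ?q := 1)"
  have fields: "field f ?M = field f M" if "f < 3" for f
    using that by (simp add: field_update)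
  have single: "(\<Sum>q<Q. real (if q = ?q then 1 else 0) * f q) = f ?q" for f :: "nat \<Rightarrow> real"
  proof -
    have "(\<Sum>q<Q. real (if q = ?q then 1 else 0) * f q) = (\<Sum>q<Q. if q = ?q then f ?q else 0)"
      by (rule sum.cong) auto
    then show ?thesis using q by simp
  qed
  have bt: "backtracked (field 0 M) (real i * grid K) Q (\<lambda>_. 0) (\<lambda>q. if q = ?q then 1 else 0)"
    using i unfolding backtracked_def single val_node[OF i(1)]
    by (auto simp: usage_def profit_def)
  have backtrack: "back_inv (real i * grid K) 0 R' ?M" if "env' R'" "R' 13 = 0" for R'
  proof (rule back_invI[where x = "\<lambda>_. 0" and c = "\<lambda>q. if q = ?q then 1 else 0"])
    show "?M j = real 0" if "j < n" for j
      using that inv'(6) by (subst low_update_cell) (auto simp: base_def)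
    show "field 3 ?M q = real (if q = ?q then 1 else 0)" for q
      using inv'(5) by (simp add: field_update)
  qed (use that inv'(3) bt fields in auto)
  have cell3: "real base + 4 * real q + 3 = real (cell 3 q)" for q
    by (simp add: cell_def)
  have "\<exists>i\<le>N. back_inv (real i * grid K) 0 R' ?M \<and>
           (\<forall>x. usage x \<le> 1 \<longrightarrow> profit x \<le> real i * grid K + 4 * P / 2 ^ K)"
    if "env' R'" "R' 13 = 0" for R'
    using backtrack[OF that] opt i(1) by blast
  then show ?thesis
    unfolding mark_prog_def
    by (simp add: R cell3 cells nat_real inv'(1) env'_update cell_address del: of_nat_add of_nat_mult of_nat_Suc One_nat_def)
qed

text \<open>The factor 60 exceeds the combined cost per iteration of the loops over each range; the
  positive term \<open>K + 1\<close> also absorbs the straight-line parts.\<close>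

definition solve_time :: nat where
  "solve_time = 60 * (n + (K + 1) + K * W * W + W + Q)"

lemma solve_correct:
  assumes env: "env R" and M: "\<And>j. j < n \<Longrightarrow> M j = p j" "\<And>j. j < n \<Longrightarrow> M (n + j) = s j"
    "\<And>i. n + n \<le> i \<Longrightarrow> M i = 0"
  shows "runs solve_prog (R, M) solve_time memory (\<lambda>R' M'. \<exists>y. (\<forall>j<n. M' j = real (y j)) \<and>
    usage y \<le> 1 \<and> (\<forall>x. usage x \<le> 1 \<longrightarrow> profit x \<le> profit y + 4 * P / 2 ^ K))"
    (is "runs _ _ _ _ ?post")
proof -
  let ?back = "\<lambda>R M. \<exists>i\<le>N. back_inv (real i * grid K) 0 R M \<and>
           (\<forall>x. usage x \<le> 1 \<longrightarrow> profit x \<le> real i * grid K + 4 * P / 2 ^ K)"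
  have backtrack: "runs (While (Less 13 17) back_body) (R, M) (Q * Suc (cost back_body) + 1) memory ?post"
    if pre: "?back R M" for R M
  proof -
    obtain i where i: "back_inv (real i * grid K) 0 R M"
      "\<And>x. usage x \<le> 1 \<Longrightarrow> profit x \<le> real i * grid K + 4 * P / 2 ^ K" using pre by blast
    have "runs (While (Less 13 17) back_body) (R, M) (Q * Suc (cost back_body) + 1) memory
        (back_inv (real i * grid K) Q)"
      by (rule runs_While[OF _ back_step i(1)]) (auto simp: back_inv_def dest: env'D)
    moreover have "?post R' M'" if inv: "back_inv (real i * grid K) Q R' M'" for R' M'
    proof -
      obtain y where "\<forall>j<n. M' j = real (y j)" "usage y \<le> 1" "real i * grid K \<le> profit y"
        using inv by (auto simp: back_inv_def backtracked_def)
      then show ?thesis using i(2) by (intro exI[of _ y]) fastforce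
    qed
    ultimately show ?thesis unfolding runs_def by blast
  qed
  have items: "runs (While (Less 13 0) item_body) (R, M) (n * Suc (cost item_body) + 1) memory (item_inv n)"
    if "item_inv 0 R M" for R M
    by (rule runs_While[OF _ item_step that]) (auto simp: item_inv_def dest: env'D)
  have pairs: "runs (While (Less 13 14) pair_body) (R, M) (K * W * W * Suc (cost pair_body) + 1) memory
      (pair_inv (K * W * W))" if "pair_inv 0 R M" for R M
    by (rule runs_While[OF _ pair_step that]) (auto simp: pair_inv_def)
  have best: "runs (While (Less 13 16) best_body) (R, M) (W * Suc (cost best_body) + 1) memory
      (best_inv W)" if "best_inv 0 R M" for R M
    by (rule runs_While[OF _ best_step that]) (auto simp: best_inv_def dest: env'D)
  have clear: "runs (While (Less 13 0) clear_body) (R, M) (n * Suc (cost clear_body) + 1) memory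
      (clear_inv n)" if "clear_inv 0 R M" for R M
    by (rule runs_While[OF _ clear_step that]) (auto simp: clear_inv_def best_inv_def env'_update dest: env'D)
  have power: "runs (While (Less 13 7) power_body) (R, M) ((K + 1) * Suc (cost power_body) + 1) memory
      (power_inv (K + 1))" if "power_inv 0 R M" for R M
    by (rule runs_While[OF _ power_step that]) (auto simp: power_inv_def env_def)
  have after_init: "power_inv 0 (R(13 := 0, 12 := 1)) M"
    using env M by (auto simp: power_inv_def env_update base_def)
  have after_items: "pair_inv 0 (R(13 := 0, 14 := real (K * W)  * real W)) M" if "item_inv n R M" for R M
    using that by (auto simp: item_inv_def pair_inv_def env'_update pairs_done_def)
  have after_pairs: "best_inv 0 (R(13 := 0, 19 := 0)) M" if "pair_inv (K * W * W) R M" for R M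
  proof -
    have "complete (field 0 M)" using that by (simp add: complete_iff pair_inv_def)
    \<comment> \<open>The zero entry of the top level fits, so 0 is a valid first candidate for the
      best index.\<close>
    then have "1 \<le> field 0 M (K * W)" using complete_zero[of "field 0 M" K] by simp
    then show ?thesis using that \<open>complete (field 0 M)\<close>
      by (auto simp: pair_inv_def best_inv_def env'_update intro!: exI[of _ "0::nat"])
  qed
  have after_best: "clear_inv 0 (R(13 := 0)) M" if "best_inv W R M" for R M
    using that by (auto simp: clear_inv_def best_inv_def env'_update)
  let ?T1 = "cost mark_prog + (Q * Suc (cost back_body) + 1)"
  have 1: "runs (mark_prog ;; While (Less 13 17) back_body) (R, M) ?T1 memory ?post"
    if "clear_inv n R M" for R M
    by (rule runs_Seq[OF runs_wp[OF mark_correct[OF that]] backtrack])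
  let ?T2 = "n * Suc (cost clear_body) + 1 + ?T1"
  have 2: "runs (Assign 13 (Reg 10) ;; While (Less 13 0) clear_body ;; mark_prog ;;
      While (Less 13 17) back_body) (R, M) (1 + ?T2) memory ?post" if "best_inv W R M" for R M
  proof -
    have "R 10 = 0" using that by (auto simp: best_inv_def dest: env'D)
    then have "wp (Assign 13 (Reg 10)) memory (clear_inv 0) R M" using after_best[OF that] by simp
    from runs_Seq[OF runs_wp[OF this] runs_Seq[OF clear 1]] show ?thesis by simp
  qed
  let ?T3 = "W * Suc (cost best_body) + 1 + (1 + ?T2)"
  have 3: "runs ((Assign 13 (Reg 10) ;; Assign 19 (Reg 10)) ;; While (Less 13 16) best_body ;;
      Assign 13 (Reg 10) ;; While (Less 13 0) clear_body ;; mark_prog ;;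
      While (Less 13 17) back_body) (R, M) (2 + ?T3) memory ?post" if "pair_inv (K * W * W) R M" for R M
  proof -
    have "R 10 = 0" using that by (auto simp: pair_inv_def dest: env'D)
    then have "wp (Assign 13 (Reg 10) ;; Assign 19 (Reg 10)) memory (best_inv 0) R M"
      using after_pairs[OF that] by simp
    from runs_Seq[OF runs_wp[OF this] runs_Seq[OF best 2]] show ?thesis by simp
  qed
  let ?T4 = "K * W * W * Suc (cost pair_body) + 1 + (2 + ?T3)"
  have 4: "runs ((Assign 13 (Reg 10) ;; Assign 14 (Mul 6 16) ;; Assign 14 (Mul 14 16)) ;;
      While (Less 13 14) pair_body ;;
      (Assign 13 (Reg 10) ;; Assign 19 (Reg 10)) ;; While (Less 13 16) best_body ;;
      Assign 13 (Reg 10) ;; While (Less 13 0) clear_body ;; mark_prog ;;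
      While (Less 13 17) back_body) (R, M) (3 + ?T4) memory ?post" if "item_inv n R M" for R M
  proof -
    have "R 10 = 0" "R 6 = real K" "R 16 = real W" using that by (auto simp: item_inv_def dest: env'D)
    then have "wp (Assign 13 (Reg 10) ;; Assign 14 (Mul 6 16) ;; Assign 14 (Mul 14 16)) memory
        (pair_inv 0) R M"
      using after_items[OF that] by simp
    from runs_Seq[OF runs_wp[OF this] runs_Seq[OF pairs 3]] show ?thesis by (simp add: numeral_eq_Suc)
  qed
  let ?T5 = "cost prepare_prog + (n * Suc (cost item_body) + 1 + (3 + ?T4))"
  have 5: "wp (Assign 13 (Reg 10) ;; Assign 12 (Reg 2)) memory (power_inv 0) R M"
    using after_init env by (simp add: env_def)
  have "runs solve_prog (R, M) (2 + ((K + 1) * Suc (cost power_body) + 1 + ?T5)) memory ?post"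
    unfolding solve_prog_def
    using runs_Seq[OF runs_wp[OF 5] runs_Seq[OF power runs_Seq[OF runs_wp[OF prepare_correct] runs_Seq[OF items 4]]]]
    by simp
  then show ?thesis
    by (rule runs_mono)
      (simp add: solve_time_def power_body_def prepare_prog_def item_body_def pair_body_def best_body_def
        clear_body_def mark_prog_def back_body_def)
qed

end

section \<open>Choosing the height and computing the largest density\<close>

definition init_prog :: prog where
  "init_prog =
     Assign 2 (Const 1) ;; Assign 3 (Const 2) ;; Assign 4 (Const 4) ;; Assign 5 (Const 8) ;;
     Assign 6 (Div 5 1) ;; Assign 6 (Add 6 2) ;; Assign 6 (Log 6) ;; Assign 6 (Floor 6) ;;
     Assign 6 (Add 6 2) ;; Assign 7 (Add 6 2) ;; Assign 8 (Add 0 0) ;; Assign 9 (Add 8 7)"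

definition density_body :: prog where
  "density_body =
     Load 20 13 ;; Assign 21 (Add 0 13) ;; Load 21 21 ;; Assign 21 (Div 20 21) ;;
     If (Less 11 21) (Assign 11 (Reg 21)) Skip ;; Assign 13 (Add 13 2)"

definition ukp_prog :: prog where
  "ukp_prog = init_prog ;; While (Less 13 0) density_body ;; solve_prog"

text \<open>The summand 1 keeps the logarithm positive for large \<epsilon>, so that the machine's
  rounded value is a natural number.\<close>

definition height :: "real \<Rightarrow> nat" where
  "height \<epsilon> = nat \<lfloor>log 2 (8 / \<epsilon> + 1)\<rfloor> + 1"

lemma height_bounds:
  assumes "\<epsilon> > 0"
  shows "real (height \<epsilon>) = of_int \<lfloor>log 2 (8 / \<epsilon> + 1)\<rfloor> + 1"
    and "8 / \<epsilon> \<le> 2 ^ height \<epsilon>" and "2 ^ height \<epsilon> \<le> 16 / \<epsilon> + 2"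
proof -
  let ?y = "8 / \<epsilon> + 1"
  have y: "?y > 1" using assms by simp
  then have "0 < log 2 ?y" by (subst zero_less_log_cancel_iff) linarith+
  then have "0 \<le> \<lfloor>log 2 ?y\<rfloor>" by simp
  then show eq: "real (height \<epsilon>) = of_int \<lfloor>log 2 ?y\<rfloor> + 1" by (simp add: height_def)
  have "log 2 ?y < real (height \<epsilon>)" unfolding eq by linarith
  then have "?y < 2 powr real (height \<epsilon>)" using y by (subst (asm) log_less_iff) linarith+
  then show "8 / \<epsilon> \<le> 2 ^ height \<epsilon>" by (simp add: powr_realpow)
  have "real (height \<epsilon> - 1) \<le> log 2 ?y" using eq by (simp add: height_def)
  then have "2 powr real (height \<epsilon> - 1) \<le> ?y" using y by (subst (asm) le_log_iff) linarith+
  then have "2 ^ (height \<epsilon> - 1) \<le> ?y" by (simp add: powr_realpow)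
  moreover have "(2::real) ^ height \<epsilon> = 2 * 2 ^ (height \<epsilon> - 1)"
    by (simp add: height_def)
  ultimately show "2 ^ height \<epsilon> \<le> 16 / \<epsilon> + 2" by simp
qed

definition table_width :: "nat \<Rightarrow> nat" where
  "table_width K = (K + 1) * 2 ^ (K + 1) + 1"

definition time_bound :: "nat \<Rightarrow> nat \<Rightarrow> nat" where
  "time_bound n K = 13 + n * 8 + 60 * (n + (K + 1) + K * table_width K * table_width K +
     table_width K + (K + 1) * table_width K)"

definition memory_bound :: "nat \<Rightarrow> nat \<Rightarrow> nat" where
  "memory_bound n K = n + n + (K + 1) + 4 * ((K + 1) * table_width K)"

definition constants :: "nat \<Rightarrow> nat \<Rightarrow> (nat \<Rightarrow> real) \<Rightarrow> bool" where
  "constants n K R \<longleftrightarrow> R 0 = real n \<and> R 2 = 1 \<and> R 3 = 2 \<and> R 4 = 4 \<and> R 6 = real K \<and>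
     R 7 = real (K + 1) \<and> R 8 = real (n + n) \<and> R 9 = real (n + n + (K + 1)) \<and> R 10 = 0"

lemma constants_update: "r \<notin> {0, 2, 3, 4, 6, 7, 8, 9, 10} \<Longrightarrow> constants n K (R(r := v)) = constants n K R"
  by (simp add: constants_def)

text \<open>The accuracy 1 is arbitrary, since the initial memory does not depend on it. The case
  \<open>R 11 = 0\<close> covers the start of the scan and is excluded at the end by positive
  profits.\<close>

definition density_inv :: "ukp \<Rightarrow> nat \<Rightarrow> nat \<Rightarrow> assn" where
  "density_inv I K k R M \<longleftrightarrow> constants (length I) K R \<and> R 13 = real k \<and>
     M = snd (initial_state 1 I) \<and> 0 \<le> R 11 \<and>
     (\<forall>j<k. fst (I ! j) \<le> R 11 * snd (I ! j)) \<and>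
     (R 11 = 0 \<or> (\<exists>j<k. fst (I ! j) = R 11 * snd (I ! j)))"

lemma instance_bounds:
  assumes "ukp_instance I" "j < length I"
  shows "0 < fst (I ! j)" "0 < snd (I ! j)" "snd (I ! j) \<le> 1"
  using assms nth_mem[OF assms(2)] by (cases "I ! j"; force simp: ukp_instance_def)+

lemma density_step:
  assumes I: "ukp_instance I" and k: "k < length I" and inv: "density_inv I K k R M"
    and m: "2 * length I \<le> m"
  shows "wp density_body m (density_inv I K (Suc k)) R M"
proof -
  let ?p = "fst (I ! k)" and ?s = "snd (I ! k)"
  have env: "constants (length I) K R" "R 13 = real k" using inv by (auto simp: density_inv_def)
  then have R: "R 0 = real (length I)" "R 2 = 1" by (auto simp: constants_def)
  note ps = instance_bounds[OF I k]
  have M: "M k = ?p" "M (length I + k) = ?s"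
  proof -
    have "M = snd (initial_state 1 I)" using inv by (simp add: density_inv_def)
    then show "M k = ?p" "M (length I + k) = ?s" using k by (simp_all add: initial_state_def Let_def)
  qed
  have addr: "k < m" "length I + k < m" using k m by auto
  have step: "density_inv I K (Suc k) R' M" if "constants (length I) K R'" "R' 13 = real (Suc k)"
    "R' 11 = ?p / ?s" "R 11 < ?p / ?s" for R'
  proof -
    have "fst (I ! j) \<le> R' 11 * snd (I ! j)" if "j < Suc k" for j
    proof (cases "j = k")
      case True then show ?thesis using ps \<open>R' 11 = ?p / ?s\<close> by simp
    next
      case False
      then have j: "j < k" using that by simp
      have "fst (I ! j) \<le> R 11 * snd (I ! j)" using inv j by (simp add: density_inv_def)
      also have "\<dots> \<le> ?p / ?s * snd (I ! j)"
        using \<open>R 11 < ?p / ?s\<close> instance_bounds[OF I, of j] j k by (intro mult_right_mono) auto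
      finally show ?thesis using \<open>R' 11 = ?p / ?s\<close> by simp
    qed
    moreover have "\<exists>j<Suc k. fst (I ! j) = R' 11 * snd (I ! j)"
      using ps that by (intro exI[of _ k]) simp
    moreover have "0 \<le> R' 11" "M = snd (initial_state 1 I)"
      using that inv by (auto simp only: density_inv_def)
    ultimately show ?thesis using that(1,2) unfolding density_inv_def by blast
  qed
  have keep: "density_inv I K (Suc k) R' M" if "constants (length I) K R'" "R' 13 = real (Suc k)"
    "R' 11 = R 11" "\<not> R 11 < ?p / ?s" for R'
  proof -
    have "?p \<le> R 11 * ?s" using that(4) ps by (simp add: field_simps)
    with that inv show ?thesis unfolding density_inv_def less_Suc_eq by metis
  qed
  show ?thesis
    unfolding density_body_def
    using ps by (simp add: R M env addr constants_update step keep nat_real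
        del: of_nat_add of_nat_mult of_nat_Suc One_nat_def)
qed

lemma density_final:
  assumes I: "ukp_instance I" and inv: "density_inv I K (length I) R M" and K: "K \<ge> 1"
  shows "ukp_rounding (length I) (\<lambda>j. fst (I ! j)) (\<lambda>j. snd (I ! j)) K (R 11)"
proof
  have dens: "fst (I ! j) \<le> R 11 * snd (I ! j)" if "j < length I" for j
    using inv that by (simp add: density_inv_def)
  have "0 < length I" using I by (simp add: ukp_instance_def)
  then have "R 11 \<noteq> 0" using dens[of 0] instance_bounds(1)[OF I, of 0] by auto
  then show "\<exists>j<length I. fst (I ! j) = R 11 * snd (I ! j)" using inv by (auto simp: density_inv_def)
qed (use inv instance_bounds[OF I] K in \<open>auto simp: density_inv_def\<close>)

lemma init_correct:
  assumes "\<epsilon> > 0"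
  shows "wp init_prog m (density_inv I (height \<epsilon>) 0) (fst (initial_state \<epsilon> I)) (snd (initial_state \<epsilon> I))"
proof -
  have "snd (initial_state \<epsilon> I) = snd (initial_state 1 I)" by (simp add: initial_state_def Let_def)
  moreover have "0 < 8 / \<epsilon> + 1" using assms by (simp add: add_pos_pos)
  ultimately show ?thesis
    using assms unfolding init_prog_def
    by (simp add: initial_state_def Let_def density_inv_def constants_def height_bounds(1)
        fun_eq_iff)
qed

lemma ukp_prog_correct:
  assumes \<epsilon>: "\<epsilon> > 0" and I: "ukp_instance I"
  shows "runs ukp_prog (initial_state \<epsilon> I) (time_bound (length I) (height \<epsilon>))
    (memory_bound (length I) (height \<epsilon>))
    (\<lambda>R M. \<exists>y. output_solution I (R, M) y \<and> feasible I y \<and> (1 - \<epsilon>) * OPT I \<le> total_profit I y)"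
    (is "runs _ _ _ ?m ?post")
proof -
  let ?n = "length I" and ?K = "height \<epsilon>"
  have K1: "?K \<ge> 1" by (simp add: height_def)
  have init: "runs init_prog (initial_state \<epsilon> I) 12 ?m (density_inv I ?K 0)"
  proof -
    have "cost init_prog = 12" by (simp add: init_prog_def)
    then show ?thesis using runs_wp[OF init_correct[OF \<epsilon>, of ?m I]] by simp
  qed
  have dens: "runs (While (Less 13 0) density_body) (R, M) (?n * 8 + 1) ?m (density_inv I ?K ?n)"
    if inv: "density_inv I ?K 0 R M" for R M
  proof -
    have "runs (While (Less 13 0) density_body) (R, M) (?n * Suc (cost density_body) + 1) ?m
        (density_inv I ?K ?n)"
      by (rule runs_While[OF _ density_step[OF I] inv])
        (auto simp: density_inv_def constants_def memory_bound_def table_width_def)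
    moreover have "cost density_body = 7" by (simp add: density_body_def)
    ultimately show ?thesis by simp
  qed
  have solve: "runs solve_prog (R, M) (time_bound ?n ?K - (13 + ?n * 8)) ?m ?post"
    if inv: "density_inv I ?K ?n R M" for R M
  proof -
    define p where "p = (\<lambda>j. fst (I ! j))"
    define s where "s = (\<lambda>j. snd (I ! j))"
    interpret ukp_rounding ?n p s ?K "R 11"
      unfolding p_def s_def by (rule density_final[OF I inv K1])
    have M: "M = snd (initial_state 1 I)" using inv by (simp add: density_inv_def)
    have Wt: "W = table_width ?K" by (simp add: W_def N_def table_width_def)
    have env: "env R" using inv by (simp add: env_def density_inv_def constants_def base_def)
    have usage: "usage x \<le> 1 \<longleftrightarrow> feasible I x" for x
      unfolding usage_def feasible_def total_size_def by (simp add: s_def)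
    have profit: "profit x = total_profit I x" for x
      unfolding profit_def total_profit_def by (simp add: p_def)
    have opt: "total_profit I x \<le> OPT I" if "feasible I x" for x
      unfolding OPT_def using that finite_feasible_profits[OF I] by (intro Max_ge) auto
    have half: "R 11 / 2 \<le> OPT I"
      using half_P_attained opt unfolding usage profit by (meson order_trans)
    have loss: "4 * R 11 / 2 ^ ?K \<le> \<epsilon> * OPT I"
    proof -
      have "8 \<le> \<epsilon> * 2 ^ ?K" using height_bounds(2)[OF \<epsilon>] \<epsilon> by (simp add: field_simps)
      then have "8 * OPT I \<le> \<epsilon> * 2 ^ ?K * OPT I" using half P_pos by (intro mult_right_mono) auto
      then have "4 * R 11 \<le> \<epsilon> * OPT I * 2 ^ ?K" using half by (simp add: mult_ac)
      then show ?thesis by (simp add: divide_le_eq)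
    qed
    have post: "?post R' M'"
      if sol: "\<forall>j<?n. M' j = real (y j)" "usage y \<le> 1"
        "\<forall>x. usage x \<le> 1 \<longrightarrow> profit x \<le> profit y + 4 * R 11 / 2 ^ ?K" for R' M' y
    proof -
      obtain x where "feasible I x" "total_profit I x = OPT I" using OPT_attained[OF I] by auto
      then have "OPT I \<le> total_profit I y + 4 * R 11 / 2 ^ ?K"
        using sol(3) unfolding usage profit by metis
      then have "(1 - \<epsilon>) * OPT I \<le> total_profit I y" using loss by (simp add: left_diff_distrib)
      then show ?thesis using sol(1,2) unfolding usage by (auto simp: output_solution_def)
    qed
    have "runs solve_prog (R, M) solve_time memory (\<lambda>R' M'. \<exists>y. (\<forall>j<?n. M' j = real (y j)) \<and>
      usage y \<le> 1 \<and> (\<forall>x. usage x \<le> 1 \<longrightarrow> profit x \<le> profit y + 4 * R 11 / 2 ^ ?K))"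
      by (rule solve_correct[OF env]) (auto simp: M initial_state_def Let_def p_def s_def)
    moreover have "solve_time = time_bound ?n ?K - (13 + ?n * 8)" "memory = ?m"
      by (simp_all add: solve_time_def time_bound_def memory_def memory_bound_def base_def Q_def Wt)
    ultimately show ?thesis
      using post unfolding runs_def by (metis (no_types, lifting))
  qed
  have "runs ukp_prog (initial_state \<epsilon> I) (12 + (?n * 8 + 1 + (time_bound ?n ?K - (13 + ?n * 8)))) ?m ?post"
    unfolding ukp_prog_def by (rule runs_Seq[OF init runs_Seq[OF dens solve]])
  moreover have "12 + (?n * 8 + 1 + (time_bound ?n ?K - (13 + ?n * 8))) = time_bound ?n ?K"
    by (simp add: time_bound_def)
  ultimately show ?thesis by simp
qed

section \<open>Time and space\<close>

lemma time_bound_le: "real (time_bound n K) \<le> 1000 * (real n + real (K + 1) ^ 3 * (2 ^ K) ^ 2)"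
proof -
  define u v where "u = K + 1" and "v = (2::nat) ^ K"
  have uv: "1 \<le> u" "1 \<le> v" by (auto simp: u_def v_def)
  then have uv1: "1 \<le> u * v" by simp
  \<comment> \<open>The width is \<open>2 * (u * v) + 1\<close>.\<close>
  have W: "table_width K \<le> 3 * (u * v)" using uv1 by (simp add: table_width_def u_def v_def)
  have u3: "u \<le> u ^ 3" "u ^ 2 \<le> u ^ 3" "v \<le> v ^ 2" using uv by (auto intro: power_increasing self_le_power)
  have a: "u * v \<le> u ^ 3 * v ^ 2" using u3 by (intro mult_mono) auto
  have b: "u ^ 2 * v \<le> u ^ 3 * v ^ 2" using u3 by (intro mult_mono) auto
  have c: "u \<le> u ^ 3 * v ^ 2" using mult_mono[OF u3(1), of 1 "v ^ 2"] uv by simp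
  have "K * table_width K * table_width K \<le> u * (3 * (u * v)) * (3 * (u * v))"
    using W by (intro mult_mono) (auto simp: u_def)
  also have "\<dots> = 9 * (u ^ 3 * v ^ 2)" by (simp add: power2_eq_square power3_eq_cube)
  finally have d: "K * table_width K * table_width K \<le> 9 * (u ^ 3 * v ^ 2)" .
  have "u * table_width K \<le> u * (3 * (u * v))" using W by (intro mult_left_mono) auto
  also have "\<dots> = 3 * (u ^ 2 * v)" by (simp add: power2_eq_square)
  finally have e: "u * table_width K \<le> 3 * (u ^ 2 * v)" .
  have "1 \<le> u ^ 3 * v ^ 2" using c uv by simp
  moreover have "13 + n * 8 + 60 * (n + u + k + w + t) \<le> 1000 * (n + x)"
    if "1 \<le> x" "w \<le> 3 * y" "y \<le> x" "z \<le> x" "u \<le> x" "k \<le> 9 * x" "t \<le> 3 * z" for k w t x y z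
    using that by simp
  ultimately have "time_bound n K \<le> 1000 * (n + u ^ 3 * v ^ 2)"
    unfolding time_bound_def u_def[symmetric] using W a b c d e by blast
  then have "real (time_bound n K) \<le> real (1000 * (n + u ^ 3 * v ^ 2))" by (subst of_nat_le_iff)
  then show ?thesis by (simp add: u_def v_def)
qed

lemma memory_bound_le: "real (memory_bound n K) \<le> 13 * (real n + real (K + 1) ^ 2 * 2 ^ K)"
proof -
  define u v where "u = K + 1" and "v = (2::nat) ^ K"
  have uv: "1 \<le> u" "1 \<le> v" by (auto simp: u_def v_def)
  then have uv1: "1 \<le> u * v" by simp
  have W: "table_width K \<le> 3 * (u * v)" using uv1 by (simp add: table_width_def u_def v_def)
  have "u * table_width K \<le> u * (3 * (u * v))" using W by (intro mult_left_mono) auto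
  also have "\<dots> = 3 * (u ^ 2 * v)" by (simp add: power2_eq_square)
  finally have e: "u * table_width K \<le> 3 * (u ^ 2 * v)" .
  have "u * 1 \<le> u ^ 2 * v" using uv by (intro mult_mono) (auto intro: self_le_power)
  moreover have "n + n + u + 4 * t \<le> 13 * (n + x)" if "t \<le> 3 * x" "u * 1 \<le> x" for t x
    using that by simp
  ultimately have "memory_bound n K \<le> 13 * (n + u ^ 2 * v)"
    unfolding memory_bound_def u_def[symmetric] using e by blast
  then have "real (memory_bound n K) \<le> real (13 * (n + u ^ 2 * v))" by (subst of_nat_le_iff)
  then show ?thesis by (simp add: u_def v_def)
qed

text \<open>Up to 1/2 the logarithm of \<open>1 / \<epsilon>\<close> is at least 1 and absorbs
  additive constants; for larger \<epsilon> the height, and with it the table, is bounded.\<close>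

lemma height_small:
  assumes "0 < \<epsilon>" "\<epsilon> \<le> 1 / 2"
  shows "1 \<le> log 2 (1 / \<epsilon>)" "real (height \<epsilon> + 1) \<le> 7 * log 2 (1 / \<epsilon>)" "2 ^ height \<epsilon> \<le> 17 / \<epsilon>"
proof -
  have "2 \<le> 1 / \<epsilon>" using assms by (simp add: field_simps)
  then show l: "1 \<le> log 2 (1 / \<epsilon>)" using assms by (simp add: le_log_iff)
  have "2 \<le> 1 / \<epsilon>" by fact
  then show "2 ^ height \<epsilon> \<le> 17 / \<epsilon>" using height_bounds(3)[OF assms(1)] by simp
  have "log 2 (8 / \<epsilon> + 1) \<le> log 2 (16 * (1 / \<epsilon>))"
    using assms by (subst log_le_cancel_iff) (auto simp: field_simps add_pos_pos)
  also have "\<dots> = log 2 16 + log 2 (1 / \<epsilon>)" using assms by (subst log_mult) auto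
  also have "log 2 16 = (4::real)" using log_of_power_eq[of 16 2 4] by simp
  finally have "real (height \<epsilon> + 1) \<le> 6 + log 2 (1 / \<epsilon>)" unfolding of_nat_add height_bounds(1)[OF assms(1)] by linarith
  then show "real (height \<epsilon> + 1) \<le> 7 * log 2 (1 / \<epsilon>)" using l by simp
qed

lemma height_large:
  assumes "1 / 2 < \<epsilon>"
  shows "height \<epsilon> \<le> 5"
proof -
  have "log 2 (8 / \<epsilon> + 1) < log 2 32"
    using assms by (subst log_less_cancel_iff) (auto simp: field_simps add_pos_pos)
  also have "log 2 32 = (5::real)" using log_of_power_eq[of 32 2 5] by simp
  finally have "real (height \<epsilon>) < 6" using height_bounds(1)[of \<epsilon>] assms by simp
  then show ?thesis by simp
qed

text \<open>For \<open>\<epsilon> > 1\<close> the summand is negative. Any lower bound above -1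
  would do: as \<open>n\<close> is at least 1, the sum then stays above a positive constant, here
  1/10.\<close>

lemma time_summand_ge:
  assumes "0 < \<epsilon>"
  shows "- (9 / 10) \<le> 1 / \<epsilon> ^ 2 * log 2 (1 / \<epsilon>) ^ 3"
proof (cases "\<epsilon> \<le> 1")
  case True
  then have "0 \<le> log 2 (1 / \<epsilon>)" using assms by (subst zero_le_log_cancel_iff) auto
  then have "0 \<le> 1 / \<epsilon> ^ 2 * log 2 (1 / \<epsilon>) ^ 3" by simp
  then show ?thesis by linarith
next
  case False
  define y where "y = ln \<epsilon>"
  have y: "y > 0" "\<epsilon> = exp y" using False assms by (auto simp: y_def)
  \<comment> \<open>The cube root of the negated summand. It remains to bound
    \<open>y * exp (- (2 * y / 3))\<close>, which is largest at \<open>y = 3 / 2\<close>.\<close>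
  define t where "t = y * exp (- (2 * y / 3)) / ln 2"
  have "t \<ge> 0" using y by (simp add: t_def)
  have "t ^ 3 = (y / ln 2) ^ 3 * exp (- (2 * y / 3)) ^ 3"
    by (simp add: t_def power_mult_distrib power_divide)
  also have "exp (- (2 * y / 3)) ^ 3 = exp (- (2 * y))"
    by (simp add: exp_of_nat_mult[symmetric])
  also have "\<dots> = 1 / \<epsilon> ^ 2" by (simp add: y(2) exp_minus exp_double inverse_eq_divide)
  finally have "t ^ 3 = (y / ln 2) ^ 3 * (1 / \<epsilon> ^ 2)" .
  moreover have "log 2 (1 / \<epsilon>) = - (y / ln 2)" using assms by (simp add: log_def ln_div y_def)
  ultimately have eq: "1 / \<epsilon> ^ 2 * log 2 (1 / \<epsilon>) ^ 3 = - (t ^ 3)" by simp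
  have "5 / 2 \<le> exp (1::real)" using exp_lower_Taylor_quadratic[of 1] by simp
  \<comment> \<open>The tangent of the exponential at the point of the maximum.\<close>
  moreover have "2 * y / 3 \<le> exp (2 * y / 3 - 1)" using exp_ge_add_one_self[of "2 * y / 3 - 1"] by simp
  ultimately have "5 / 2 * (2 * y / 3) \<le> exp 1 * exp (2 * y / 3 - 1)"
    using y by (intro mult_mono) auto
  also have "\<dots> = exp (2 * y / 3)" by (simp add: exp_add[symmetric])
  finally have "y * exp (- (2 * y / 3)) \<le> 3 / 5" by (simp add: exp_minus field_simps)
  also have "3 / 5 \<le> 19 / 20 * ln (2::real)"
  proof -
    \<comment> \<open>A lower bound on \<open>ln 2\<close> from the telescoping product of 4/5, 5/6,
      6/7 and 7/8, which is 1/2.\<close>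
    have "ln (8::real) = ln 4 + ln 2" using ln_mult[of 4 "2::real"] by simp
    then have "ln (2::real) = - (ln (4 / 5) + ln (5 / 6) + ln (6 / 7) + ln (7 / 8))"
      by (simp add: ln_div)
    moreover have "ln (4 / 5) \<le> - (1 / 5 :: real)" "ln (5 / 6) \<le> - (1 / 6 :: real)"
      "ln (6 / 7) \<le> - (1 / 7 :: real)" "ln (7 / 8) \<le> - (1 / 8 :: real)"
      using ln_le_minus_one[of "4 / 5 :: real"] ln_le_minus_one[of "5 / 6 :: real"]
        ln_le_minus_one[of "6 / 7 :: real"] ln_le_minus_one[of "7 / 8 :: real"] by simp_all
    ultimately show ?thesis by simp
  qed
  finally have "t \<le> 19 / 20" by (simp add: t_def divide_le_eq)
  then have "t ^ 3 \<le> (19 / 20) ^ 3" using \<open>t \<ge> 0\<close> by (intro power_mono)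
  then show ?thesis unfolding eq by (simp add: power3_eq_cube)
qed

lemma time_bound_asymptotic:
  assumes "0 < \<epsilon>" "1 \<le> n"
  shows "real (time_bound n (height \<epsilon>)) \<le> 10 ^ 10 * (real n + 1 / \<epsilon> ^ 2 * log 2 (1 / \<epsilon>) ^ 3)"
proof (cases "\<epsilon> \<le> 1 / 2")
  case True
  note h = height_small[OF assms(1) True]
  let ?X = "1 / \<epsilon> ^ 2 * log 2 (1 / \<epsilon>) ^ 3"
  have "real (height \<epsilon> + 1) ^ 3 * (2 ^ height \<epsilon>) ^ 2 \<le> (7 * log 2 (1 / \<epsilon>)) ^ 3 * (17 / \<epsilon>) ^ 2"
    using h by (intro mult_mono power_mono) auto
  also have "\<dots> = 7 ^ 3 * 17 ^ 2 * ?X" by (simp add: power_mult_distrib power_divide)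
  finally have *: "real (height \<epsilon> + 1) ^ 3 * (2 ^ height \<epsilon>) ^ 2 \<le> 99127 * ?X" by simp
  have "0 \<le> ?X" using h(1) by simp
  then show ?thesis using * time_bound_le[of n "height \<epsilon>"] by (simp del: of_nat_add)
next
  case False
  then have h: "height \<epsilon> \<le> 5" using height_large by simp
  have "real (height \<epsilon> + 1) ^ 3 * (2 ^ height \<epsilon>) ^ 2 \<le> 6 ^ 3 * (2 ^ 5) ^ 2"
    using h by (intro mult_mono power_mono power_increasing) auto
  then have "real (time_bound n (height \<epsilon>)) \<le> 1000 * (real n + 221184)"
    using time_bound_le[of n "height \<epsilon>"] by simp
  moreover have "real n - 9 / 10 \<le> real n + 1 / \<epsilon> ^ 2 * log 2 (1 / \<epsilon>) ^ 3"
    using time_summand_ge[OF assms(1)] by simp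
  then have "10 ^ 10 * (real n - 9 / 10) \<le> 10 ^ 10 * (real n + 1 / \<epsilon> ^ 2 * log 2 (1 / \<epsilon>) ^ 3)"
    by (intro mult_left_mono) auto
  \<comment> \<open>The case \<open>n = 1\<close> dictates the constant: there the right-hand side
    is only \<open>10 ^ 9\<close>.\<close>
  moreover have "1000 * (real n + 221184) \<le> 10 ^ 10 * (real n - 9 / 10)" using assms(2) by simp
  ultimately show ?thesis by linarith
qed

text \<open>As \<open>K + 1 \<le> 2 ^ K\<close>, the cubed height costs at most three further powers
  of \<open>2 ^ K\<close>; with the two of the table this gives the exponent 5. The factor 18 comes
  from \<open>16 / \<epsilon> + 2\<close>, with 2 absorbed by \<open>n \<ge> 1\<close>.\<close>

lemma time_bound_polynomial:
  assumes "0 < \<epsilon>" "1 \<le> n"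
  shows "real (time_bound n (height \<epsilon>)) \<le> 1000 * (1 + 18 ^ 5) * (real n + 1 / \<epsilon>) ^ 5"
proof -
  define v a where "v = (2::real) ^ height \<epsilon>" and "a = real n + 1 / \<epsilon>"
  have "real n \<le> a" using assms by (simp add: a_def)
  then have a: "1 \<le> a" "real n \<le> a" using assms(2) by simp_all
  have "k + 1 \<le> 2 ^ k" for k :: nat by (induction k) auto
  then have "height \<epsilon> + 1 \<le> 2 ^ height \<epsilon>" .
  then have "real (height \<epsilon> + 1) \<le> real (2 ^ height \<epsilon>)" by (subst of_nat_le_iff)
  then have "real (height \<epsilon> + 1) ^ 3 * v ^ 2 \<le> v ^ 3 * v ^ 2"
    by (intro mult_right_mono power_mono) (auto simp: v_def)
  also have "\<dots> = v ^ 5" by (simp add: power_add[symmetric])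
  also have "v \<le> 18 * a"
  proof -
    have "16 / \<epsilon> \<le> 18 / \<epsilon>" "1 \<le> real n" using assms by (simp_all add: divide_right_mono)
    then show ?thesis using height_bounds(3)[OF assms(1)] by (simp add: v_def a_def)
  qed
  then have "v ^ 5 \<le> (18 * a) ^ 5" by (intro power_mono) (auto simp: v_def)
  finally have "real (height \<epsilon> + 1) ^ 3 * v ^ 2 \<le> 18 ^ 5 * a ^ 5" by (simp add: power_mult_distrib)
  moreover have "a \<le> a ^ 5" using a by (intro self_le_power) auto
  then have "real n \<le> a ^ 5" using a by simp
  ultimately show ?thesis
    using time_bound_le[of n "height \<epsilon>"] unfolding v_def[symmetric] a_def[symmetric] by simp
qed

lemma memory_bound_asymptotic:
  assumes "0 < \<epsilon>" "1 \<le> n"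
  shows "real (memory_bound n (height \<epsilon>)) \<le> 10 ^ 10 * (real n + 1 / \<epsilon> * log 2 (1 / \<epsilon>) ^ 2)"
proof (cases "\<epsilon> \<le> 1 / 2")
  case True
  note h = height_small[OF assms(1) True]
  let ?X = "1 / \<epsilon> * log 2 (1 / \<epsilon>) ^ 2"
  have "real (height \<epsilon> + 1) ^ 2 * 2 ^ height \<epsilon> \<le> (7 * log 2 (1 / \<epsilon>)) ^ 2 * (17 / \<epsilon>)"
    using h by (intro mult_mono power_mono) auto
  also have "\<dots> = 7 ^ 2 * 17 * ?X" by (simp add: power_mult_distrib)
  finally have *: "real (height \<epsilon> + 1) ^ 2 * 2 ^ height \<epsilon> \<le> 833 * ?X" by simp
  have "0 \<le> ?X" using assms by simp
  then show ?thesis using * memory_bound_le[of n "height \<epsilon>"] by (simp del: of_nat_add)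
next
  case False
  then have h: "height \<epsilon> \<le> 5" using height_large by simp
  have "real (height \<epsilon> + 1) ^ 2 * 2 ^ height \<epsilon> \<le> 6 ^ 2 * 2 ^ 5"
    using h by (intro mult_mono power_mono power_increasing) auto
  then have "real (memory_bound n (height \<epsilon>)) \<le> 13 * (real n + 1152)"
    using memory_bound_le[of n "height \<epsilon>"] by simp
  moreover have "13 * (real n + 1152) \<le> 10 ^ 10 * real n" using assms(2) by simp
  moreover have "10 ^ 10 * real n \<le> 10 ^ 10 * (real n + 1 / \<epsilon> * log 2 (1 / \<epsilon>) ^ 2)"
    using assms by (intro mult_left_mono) auto
  ultimately show ?thesis by linarith
qed

theorem theorem1:
  "\<exists>A. ukp_fptas A
     \<and> (\<exists>C. runs_in_time A (\<lambda>n \<epsilon>. C * (real n + 1 / \<epsilon> ^ 2 * (log 2 (1 / \<epsilon>)) ^ 3)))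
     \<and> (\<exists>C. runs_in_space A (\<lambda>n \<epsilon>. C * (real n + 1 / \<epsilon> * (log 2 (1 / \<epsilon>)) ^ 2)))"
proof -
  have run: "\<exists>t m \<sigma> x. exec ukp_prog (initial_state \<epsilon> I) t m \<sigma> \<and>
      real t \<le> real (time_bound (length I) (height \<epsilon>)) \<and>
      real (max (2 * length I) m) \<le> real (memory_bound (length I) (height \<epsilon>)) \<and>
      output_solution I \<sigma> x \<and> feasible I x \<and> (1 - \<epsilon>) * OPT I \<le> total_profit I x"
    if \<epsilon>: "0 < \<epsilon>" and I: "ukp_instance I" for \<epsilon> I
  proof -
    obtain t m R M y where "exec ukp_prog (initial_state \<epsilon> I) t m (R, M)"
      "t \<le> time_bound (length I) (height \<epsilon>)" "m \<le> memory_bound (length I) (height \<epsilon>)"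
      "output_solution I (R, M) y" "feasible I y" "(1 - \<epsilon>) * OPT I \<le> total_profit I y"
      using ukp_prog_correct[OF \<epsilon> I] unfolding runs_def by blast
    moreover have "2 * length I \<le> memory_bound (length I) (height \<epsilon>)" by (simp add: memory_bound_def)
    ultimately show ?thesis
      by (intro exI[of _ t] exI[of _ m] exI[of _ "(R, M)"] exI[of _ y]) simp
  qed
  have len: "1 \<le> length I" if "ukp_instance I" for I
    using that by (cases I) (auto simp: ukp_instance_def)
  have "ukp_approximation_scheme ukp_prog"
    unfolding ukp_approximation_scheme_def using run by blast
  moreover have "runs_in_time ukp_prog (\<lambda>n \<epsilon>. 1000 * (1 + 18 ^ 5) * (real n + 1 / \<epsilon>) ^ 5)"
    unfolding runs_in_time_def using run len time_bound_polynomial by (meson order_trans)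
  moreover have "runs_in_time ukp_prog (\<lambda>n \<epsilon>. 10 ^ 10 * (real n + 1 / \<epsilon> ^ 2 * (log 2 (1 / \<epsilon>)) ^ 3))"
    unfolding runs_in_time_def using run len time_bound_asymptotic by (meson order_trans)
  moreover have "runs_in_space ukp_prog (\<lambda>n \<epsilon>. 10 ^ 10 * (real n + 1 / \<epsilon> * (log 2 (1 / \<epsilon>)) ^ 2))"
    unfolding runs_in_space_def using run len memory_bound_asymptotic by (meson order_trans)
  ultimately show ?thesis unfolding ukp_fptas_def by blast
qed

end
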